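(* Let $H$ be a subgroup of a finite group $G$. The map $\mu_p\colon G\to\mathbb{C}\Gamma_H(G)$, $\mu_p(g):=\sum_{A\in\mathcal{P}_H(G/H),\,A\ni g^{-1}}(A,g)$, induces an isomorphism of $\mathbb{C}$-algebras $$\mathbb{C}^H_{par}G\;\longrightarrow\;\mathbb{C}\Gamma_H(G),\qquad [g]\longmapsto\sum_{A\in\mathcal{P}_H(G/H),\,A\ni g^{-1}}(A,g),$$ whose inverse is given by $(A,g)\mapsto[g]\cdot[P_A]$, where $[P_A]:=\prod_{g\in A}[g][g^{-1}]\prod_{\bar g\in G\setminus A}(1-[\bar g][\bar g^{-1}])$.
   Context: $\mathcal{P}_H(G/H):=\{A\subseteq G\mid H\subseteq A\text{ and }A\text{ is a union of left cosets of }H\}$. $\Gamma_H(G):=\{(A,g)\in\mathcal{P}_H(G/H)\times G\mid g^{-1}\in A\}$ is the groupoid with operation $(A,g)\cdot(B,h):=(B,gh)$ if $A=hB$, and undefined otherwise (objects: the elements of $\mathcal{P}_H(G/H)$; source $s(A,g)=A$; range $r(A,g)=gA$; units $(A,1_G)$; inverse $(A,g)^{-1}=(gA,g^{-1})$). The groupoid algebra $\mathbb{C}\Gamma_H(G)$ has $\Gamma_H(G)$ as $\mathbb{C}$-basis, and the product of two elements of $\Gamma_H(G)$ is $0$ when it is not defined in $\Gamma_H(G)$. $\mathbb{C}^H_{par}G$ is the associative unital $\mathbb{C}$-algebra generated by the symbols $\{[g]\mid g\in G\}$ subject to the relations, for all $g,g'\in G$ and $h\in H$: $[1_G][g]=[g][1_G]=[g]$;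 $[g^{-1}][g][g']=[g^{-1}][gg']$; $[g'][g][g^{-1}]=[g'g][g^{-1}]$; $[h][h^{-1}]=[1_G]$. Its unit is $1=[1_G]$. The elements $[g][g^{-1}]$ are commuting idempotents, so the order of the factors in $[P_A]$ is irrelevant. *)

theory Defs
  imports
    Complex_Main
    "HOL-Library.Poly_Mapping"
    "HOL-Algebra.Module"
    "HOL-Algebra.QuotRing"
    "HOL-Algebra.Left_Coset"
begin

text \<open>
  Complex algebras are represented by the record type \<^type>\<open>module\<close> with scalars in
  \<^typ>\<open>complex\<close>; the locale \<^locale>\<open>algebra\<close> of HOL-Algebra is not used because it
  requires commutative multiplication.
\<close>

definition algebra_hom ::
    "(complex, 'a) module \<Rightarrow> (complex, 'b) module \<Rightarrow> ('a \<Rightarrow> 'b) set" where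
  "algebra_hom R S = {f \<in> ring_hom R S.
     \<forall>c. \<forall>x\<in>carrier R. f (c \<odot>\<^bsub>R\<^esub> x) = c \<odot>\<^bsub>S\<^esub> f x}"

definition algebra_iso ::
    "(complex, 'a) module \<Rightarrow> (complex, 'b) module \<Rightarrow> ('a \<Rightarrow> 'b) set" where
  "algebra_iso R S = {f \<in> algebra_hom R S. bij_betw f (carrier R) (carrier S)}"

text \<open>
  The algebra with basis \<open>S\<close> whose multiplication extends the partial operation \<open>m\<close> on \<open>S\<close>
  bilinearly, undefined products being \<open>0\<close>. The unit \<open>u\<close> is supplied separately, since it
  need not be a basis element.
\<close>

definition basis_algebra ::
    "'s set \<Rightarrow> ('s \<Rightarrow> 's \<Rightarrow> 's option) \<Rightarrow> ('s \<Rightarrow>\<^sub>0 complex) \<Rightarrow> (complex, 's \<Rightarrow>\<^sub>0 complex) module" where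
  "basis_algebra S m u =
    \<lparr>carrier = {f. Poly_Mapping.keys f \<subseteq> S},
     mult = (\<lambda>f g. \<Sum>x\<in>Poly_Mapping.keys f. \<Sum>y\<in>Poly_Mapping.keys g.
       (case m x y of None \<Rightarrow> 0
        | Some z \<Rightarrow> Poly_Mapping.single z (Poly_Mapping.lookup f x * Poly_Mapping.lookup g y))),
     one = u,
     zero = 0,
     add = (+),
     smult = (\<lambda>c. Poly_Mapping.map ((*) c))\<rparr>"

abbreviation basis_elem :: "'s \<Rightarrow> 's \<Rightarrow>\<^sub>0 complex" where
  "basis_elem x \<equiv> Poly_Mapping.single x 1"

text \<open>Words over \<open>X\<close> form a basis of the free associative unital algebra on \<open>X\<close>.\<close>

definition free_algebra :: "'x set \<Rightarrow> (complex, 'x list \<Rightarrow>\<^sub>0 complex) module" where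
  "free_algebra X = basis_algebra (lists X) (\<lambda>v w. Some (v @ w)) (basis_elem [])"

definition quotient_algebra ::
    "(complex, 'a) module \<Rightarrow> 'a set \<Rightarrow> (complex, 'a set) module" where
  "quotient_algebra R I =
    \<lparr>carrier = carrier (R Quot I), mult = mult (R Quot I), one = one (R Quot I),
     zero = zero (R Quot I), add = add (R Quot I),
     smult = (\<lambda>c A. \<Union>a\<in>A. I +>\<^bsub>R\<^esub> (c \<odot>\<^bsub>R\<^esub> a))\<rparr>"

text \<open>
  The first set identifies the generator of the neutral element with the unit (the empty
  word), as the neutral generator is the unit of the algebra being presented.
\<close>

definition par_relations ::
    "('a, 'm) monoid_scheme \<Rightarrow> 'a set \<Rightarrow> ('a list \<Rightarrow>\<^sub>0 complex) set" where
  "par_relations G H =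
     {basis_elem [\<one>\<^bsub>G\<^esub>] - basis_elem []} \<union>
     {basis_elem [\<one>\<^bsub>G\<^esub>, g] - basis_elem [g] | g. g \<in> carrier G} \<union>
     {basis_elem [g, \<one>\<^bsub>G\<^esub>] - basis_elem [g] | g. g \<in> carrier G} \<union>
     {basis_elem [inv\<^bsub>G\<^esub> g, g, g'] - basis_elem [inv\<^bsub>G\<^esub> g, g \<otimes>\<^bsub>G\<^esub> g'] | g g'.
        g \<in> carrier G \<and> g' \<in> carrier G} \<union>
     {basis_elem [g', g, inv\<^bsub>G\<^esub> g] - basis_elem [g' \<otimes>\<^bsub>G\<^esub> g, inv\<^bsub>G\<^esub> g] | g g'.
        g \<in> carrier G \<and> g' \<in> carrier G} \<union>
     {basis_elem [h, inv\<^bsub>G\<^esub> h] - basis_elem [\<one>\<^bsub>G\<^esub>] | h. h \<in> H}"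

definition par_ideal ::
    "('a, 'm) monoid_scheme \<Rightarrow> 'a set \<Rightarrow> ('a list \<Rightarrow>\<^sub>0 complex) set" where
  "par_ideal G H = Idl\<^bsub>free_algebra (carrier G)\<^esub> (par_relations G H)"

definition par_algebra ::
    "('a, 'm) monoid_scheme \<Rightarrow> 'a set \<Rightarrow> (complex, ('a list \<Rightarrow>\<^sub>0 complex) set) module" where
  "par_algebra G H = quotient_algebra (free_algebra (carrier G)) (par_ideal G H)"

definition par_gen ::
    "('a, 'm) monoid_scheme \<Rightarrow> 'a set \<Rightarrow> 'a \<Rightarrow> ('a list \<Rightarrow>\<^sub>0 complex) set" where
  "par_gen G H g = par_ideal G H +>\<^bsub>free_algebra (carrier G)\<^esub> basis_elem [g]"

definition par_idem ::
    "('a, 'm) monoid_scheme \<Rightarrow> 'a set \<Rightarrow> 'a \<Rightarrow> ('a list \<Rightarrow>\<^sub>0 complex) set" where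
  "par_idem G H g = par_gen G H g \<otimes>\<^bsub>par_algebra G H\<^esub> par_gen G H (inv\<^bsub>G\<^esub> g)"

text \<open>
  The algebra is not commutative, but the factors below commute with each other, which is all
  that is needed for the value of \<^const>\<open>finprod\<close> (a fold over a finite set) to be determined.
\<close>

definition par_proj ::
    "('a, 'm) monoid_scheme \<Rightarrow> 'a set \<Rightarrow> 'a set \<Rightarrow> ('a list \<Rightarrow>\<^sub>0 complex) set" where
  "par_proj G H A =
     finprod (par_algebra G H) (par_idem G H) A \<otimes>\<^bsub>par_algebra G H\<^esub>
     finprod (par_algebra G H)
       (\<lambda>g. \<one>\<^bsub>par_algebra G H\<^esub> \<ominus>\<^bsub>par_algebra G H\<^esub> par_idem G H g) (carrier G - A)"

definition coset_unions :: "('a, 'm) monoid_scheme \<Rightarrow> 'a set \<Rightarrow> 'a set set" where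
  "coset_unions G H =
     {A. A \<subseteq> carrier G \<and> H \<subseteq> A \<and> (\<exists>C. C \<subseteq> lcosets\<^bsub>G\<^esub> H \<and> A = \<Union>C)}"

definition par_groupoid :: "('a, 'm) monoid_scheme \<Rightarrow> 'a set \<Rightarrow> ('a set \<times> 'a) set" where
  "par_groupoid G H = {(A, g). A \<in> coset_unions G H \<and> g \<in> carrier G \<and> inv\<^bsub>G\<^esub> g \<in> A}"

definition groupoid_mult ::
    "('a, 'm) monoid_scheme \<Rightarrow> 'a set \<times> 'a \<Rightarrow> 'a set \<times> 'a \<Rightarrow> ('a set \<times> 'a) option" where
  "groupoid_mult G = (\<lambda>(A, g) (B, h).
     if A = h <#\<^bsub>G\<^esub> B then Some (B, g \<otimes>\<^bsub>G\<^esub> h) else None)"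

text \<open>For finite \<open>G\<close> the unit is the sum of the units of the finitely many objects.\<close>

definition groupoid_algebra ::
    "('a, 'm) monoid_scheme \<Rightarrow> 'a set \<Rightarrow> (complex, 'a set \<times> 'a \<Rightarrow>\<^sub>0 complex) module" where
  "groupoid_algebra G H =
     basis_algebra (par_groupoid G H) (groupoid_mult G)
       (\<Sum>A\<in>coset_unions G H. basis_elem (A, \<one>\<^bsub>G\<^esub>))"

definition mu_p ::
    "('a, 'm) monoid_scheme \<Rightarrow> 'a set \<Rightarrow> 'a \<Rightarrow> ('a set \<times> 'a \<Rightarrow>\<^sub>0 complex)" where
  "mu_p G H g = (\<Sum>A\<in>{A \<in> coset_unions G H. inv\<^bsub>G\<^esub> g \<in> A}. basis_elem (A, g))"

end

theory Submission
  imports Defs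
begin

text \<open>
  Write \<open>e\<^sub>g = [g][g\<^sup>-\<^sup>1]\<close>. The relations give \<open>[g] e\<^sub>h = e\<^sub>g\<^sub>h [g]\<close>, so the \<open>e\<^sub>g\<close> are commuting
  idempotents, and \<open>e\<^sub>g\<^sub>h = e\<^sub>g\<close> for \<open>h \<in> H\<close>. Hence the \<open>[P\<^sub>A]\<close> are orthogonal idempotents with sum
  \<open>1\<close>, they vanish unless \<open>A\<close> is a union of left cosets containing \<open>H\<close>, and \<open>[g][P\<^sub>A] = [P\<^sub>g\<^sub>A][g]\<close>
  vanishes unless \<open>g\<^sup>-\<^sup>1 \<in> A\<close>. It follows that the elements \<open>[g][P\<^sub>A]\<close> multiply like the arrows
  \<open>(A, g)\<close> of the groupoid, so \<open>(A, g) \<mapsto> [g][P\<^sub>A]\<close> is an algebra homomorphism; it sends the image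
  of \<open>[g]\<close> back to \<open>[g]\<close>. In the other direction \<open>[P\<^sub>A]\<close> goes to \<open>(A, 1)\<close>, because \<open>(B, 1)\<close> is a
  joint eigenvector of the images of the \<open>e\<^sub>g\<close> with spectrum \<open>B\<close>. So the two homomorphisms
  are mutually inverse.
\<close>

subsection \<open>Complex algebras\<close>

text \<open>Scalars form a whole type rather than a second carrier, so the module laws are put
  directly on top of a possibly noncommutative ring. The last two assumptions make its
  multiplication complex bilinear.\<close>

locale complex_algebra = ring R for R :: "(complex, 'a) module" (structure) +
  assumes smult_closed [intro, simp]: "x \<in> carrier R \<Longrightarrow> c \<odot> x \<in> carrier R"
    and smult_l_distr: "x \<in> carrier R \<Longrightarrow> (a + b) \<odot> x = (a \<odot> x) \<oplus> (b \<odot> x)"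
    and smult_r_distr:
      "x \<in> carrier R \<Longrightarrow> y \<in> carrier R \<Longrightarrow> c \<odot> (x \<oplus> y) = (c \<odot> x) \<oplus> (c \<odot> y)"
    and smult_assoc: "x \<in> carrier R \<Longrightarrow> (a * b) \<odot> x = a \<odot> (b \<odot> x)"
    and smult_one [simp]: "x \<in> carrier R \<Longrightarrow> 1 \<odot> x = x"
    and smult_mult_l: "x \<in> carrier R \<Longrightarrow> y \<in> carrier R \<Longrightarrow> (c \<odot> x) \<otimes> y = c \<odot> (x \<otimes> y)"
    and smult_mult_r: "x \<in> carrier R \<Longrightarrow> y \<in> carrier R \<Longrightarrow> x \<otimes> (c \<odot> y) = c \<odot> (x \<otimes> y)"
begin

lemma smult_zero_left [simp]: "x \<in> carrier R \<Longrightarrow> 0 \<odot> x = \<zero>"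
  using smult_l_distr[of x 0 0] add.l_cancel_one' by fastforce

lemma smult_zero_right [simp]: "c \<odot> \<zero> = \<zero>"
  using smult_r_distr[of \<zero> \<zero> c] add.l_cancel_one' by fastforce

lemma smult_mult_smult:
  "x \<in> carrier R \<Longrightarrow> y \<in> carrier R \<Longrightarrow> (a \<odot> x) \<otimes> (b \<odot> y) = (a * b) \<odot> (x \<otimes> y)"
  by (simp add: smult_mult_l smult_mult_r smult_assoc[symmetric] mult.commute)

text \<open>Scaling by \<open>c\<close> is multiplication by the ring element
  \<open>c \<odot> \<one>\<close>. Hence an ideal in the sense of rings, such as
  \<open>par_ideal\<close>, is automatically a subspace.\<close>

lemma ideal_smult_closed:
  assumes "ideal I R" "x \<in> I"
  shows "c \<odot> x \<in> I"
proof -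
  interpret ideal I R by fact
  have "(c \<odot> \<one>) \<otimes> x \<in> I" using assms(2) by (intro I_l_closed) auto
  then show ?thesis using assms(2) a_subset by (simp add: smult_mult_l subset_iff)
qed

end

lemma algebra_homI:
  assumes "\<And>x. x \<in> carrier R \<Longrightarrow> h x \<in> carrier S"
    and "\<And>x y. x \<in> carrier R \<Longrightarrow> y \<in> carrier R \<Longrightarrow> h (x \<otimes>\<^bsub>R\<^esub> y) = h x \<otimes>\<^bsub>S\<^esub> h y"
    and "\<And>x y. x \<in> carrier R \<Longrightarrow> y \<in> carrier R \<Longrightarrow> h (x \<oplus>\<^bsub>R\<^esub> y) = h x \<oplus>\<^bsub>S\<^esub> h y"
    and "h \<one>\<^bsub>R\<^esub> = \<one>\<^bsub>S\<^esub>"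
    and "\<And>c x. x \<in> carrier R \<Longrightarrow> h (c \<odot>\<^bsub>R\<^esub> x) = c \<odot>\<^bsub>S\<^esub> h x"
  shows "h \<in> algebra_hom R S"
  using assms by (simp add: algebra_hom_def ring_hom_memI)

lemma algebra_homD:
  assumes "h \<in> algebra_hom R S"
  shows "x \<in> carrier R \<Longrightarrow> h x \<in> carrier S"
    and "x \<in> carrier R \<Longrightarrow> y \<in> carrier R \<Longrightarrow> h (x \<otimes>\<^bsub>R\<^esub> y) = h x \<otimes>\<^bsub>S\<^esub> h y"
    and "x \<in> carrier R \<Longrightarrow> y \<in> carrier R \<Longrightarrow> h (x \<oplus>\<^bsub>R\<^esub> y) = h x \<oplus>\<^bsub>S\<^esub> h y"
    and "h \<one>\<^bsub>R\<^esub> = \<one>\<^bsub>S\<^esub>"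
    and "x \<in> carrier R \<Longrightarrow> h (c \<odot>\<^bsub>R\<^esub> x) = c \<odot>\<^bsub>S\<^esub> h x"
  using assms by (auto simp: algebra_hom_def ring_hom_closed ring_hom_mult ring_hom_add ring_hom_one)

lemma algebra_hom_ring_hom_ring:
  "\<lbrakk>h \<in> algebra_hom R S; complex_algebra R; complex_algebra S\<rbrakk> \<Longrightarrow> ring_hom_ring R S h"
  by (simp add: algebra_hom_def complex_algebra.axioms(1) ring_hom_ringI2)

lemma algebra_hom_zero:
  "\<lbrakk>h \<in> algebra_hom R S; complex_algebra R; complex_algebra S\<rbrakk> \<Longrightarrow> h \<zero>\<^bsub>R\<^esub> = \<zero>\<^bsub>S\<^esub>"
  by (simp add: algebra_hom_def complex_algebra.axioms(1) ring_hom_zero)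

lemma id_algebra_hom: "(\<lambda>x. x) \<in> algebra_hom R R"
  by (rule algebra_homI) auto

lemma algebra_hom_comp:
  "\<lbrakk>f \<in> algebra_hom R S; g \<in> algebra_hom S T\<rbrakk> \<Longrightarrow> (\<lambda>x. g (f x)) \<in> algebra_hom R T"
  by (rule algebra_homI) (simp_all add: algebra_homD)

subsection \<open>Algebras with a basis\<close>

lemma lookup_scale [simp]:
  "Poly_Mapping.lookup (Poly_Mapping.map ((*) c) f) x = (c::complex) * Poly_Mapping.lookup f x"
  by (simp add: map.rep_eq when_def)

lemma scale_single [simp]:
  "Poly_Mapping.map ((*) c) (Poly_Mapping.single x a) = Poly_Mapping.single x ((c::complex) * a)"
  by (rule poly_mapping_eqI) (simp add: lookup_single when_def)

lemma scale_add:
  "Poly_Mapping.map ((*) c) (f + g) = Poly_Mapping.map ((*) c) f + Poly_Mapping.map ((*) (c::complex)) g"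
  by (rule poly_mapping_eqI) (simp add: lookup_add algebra_simps)

lemma scale_zero [simp]: "Poly_Mapping.map ((*) (c::complex)) 0 = 0"
  by (rule poly_mapping_eqI) simp

text \<open>Linear induction for finitely supported functions. In the step \<open>x\<close> may
  already lie in the support of \<open>p\<close>, which suits properties that are additive in
  \<open>p\<close>.\<close>

lemma keys_subset_induct [consumes 1, case_names zero add]:
  fixes p :: "'s \<Rightarrow>\<^sub>0 complex"
  assumes "Poly_Mapping.keys p \<subseteq> S"
    and zero: "P 0"
    and add: "\<And>p x c. \<lbrakk>Poly_Mapping.keys p \<subseteq> S; x \<in> S; P p\<rbrakk> \<Longrightarrow> P (p + Poly_Mapping.single x c)"
  shows "P p"
proof -
  have "finite F \<Longrightarrow> Poly_Mapping.keys p = F \<Longrightarrow> F \<subseteq> S \<Longrightarrow> P p" for F p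
  proof (induction F arbitrary: p rule: finite_induct)
    case empty
    then show ?case
      by (metis keys_eq_empty zero)
  next
    case (insert x F)
    \<comment> \<open>Removing the whole term at \<open>x\<close> leaves a function with support
      exactly \<open>F\<close>.\<close>
    define c where "c = Poly_Mapping.lookup p x"
    define q where "q = p - Poly_Mapping.single x c"
    have "Poly_Mapping.lookup q y = (if y = x then 0 else Poly_Mapping.lookup p y)" for y
      by (simp add: q_def c_def lookup_minus lookup_single when_def)
    then have "Poly_Mapping.keys q = F"
      using insert.prems(1) insert.hyps(2) by (auto simp: in_keys_iff set_eq_iff)
    then have "P q" and "Poly_Mapping.keys q \<subseteq> S" and "x \<in> S"
      using insert.IH insert.prems(2) by blast+
    then have "P (q + Poly_Mapping.single x c)"
      by (intro add)
    then show ?case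
      by (simp add: q_def)
  qed
  from this[OF finite_keys refl assms(1)] show ?thesis .
qed

lemma basis_algebra_simps [simp]:
  "carrier (basis_algebra S m u) = {f. Poly_Mapping.keys f \<subseteq> S}"
  "\<one>\<^bsub>basis_algebra S m u\<^esub> = u"
  "\<zero>\<^bsub>basis_algebra S m u\<^esub> = 0"
  "f \<oplus>\<^bsub>basis_algebra S m u\<^esub> g = f + g"
  "c \<odot>\<^bsub>basis_algebra S m u\<^esub> f = Poly_Mapping.map ((*) c) f"
  by (simp_all add: basis_algebra_def)

section \<open>Bilinear multiplication from a partial operation\<close>

definition opt_single :: "'s option \<Rightarrow> complex \<Rightarrow> 's \<Rightarrow>\<^sub>0 complex" where
  "opt_single w c = (case w of None \<Rightarrow> 0 | Some z \<Rightarrow> Poly_Mapping.single z c)"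

lemma opt_single_simps [simp]:
  "opt_single None c = 0"
  "opt_single (Some z) c = Poly_Mapping.single z c"
  "opt_single w 0 = 0"
  by (simp_all add: opt_single_def split: option.split)

lemma opt_single_add: "opt_single w (a + b) = opt_single w a + opt_single w b"
  by (cases w) (simp_all add: single_add)

lemma scale_opt_single [simp]: "Poly_Mapping.map ((*) c) (opt_single w a) = opt_single w (c * a)"
  by (cases w) simp_all

lemma scale_sum:
  "Poly_Mapping.map ((*) c) (sum h X) = (\<Sum>x\<in>X. Poly_Mapping.map ((*) (c::complex)) (h x))"
  by (induction X rule: infinite_finite_induct) (simp_all add: scale_add)

lemma basis_mult_def:
  "f \<otimes>\<^bsub>basis_algebra S m u\<^esub> g =
    (\<Sum>x\<in>Poly_Mapping.keys f. \<Sum>y\<in>Poly_Mapping.keys g.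
      opt_single (m x y) (Poly_Mapping.lookup f x * Poly_Mapping.lookup g y))"
  by (simp add: basis_algebra_def opt_single_def)

text \<open>Terms outside the supports have coefficient 0. Enlarged index sets are needed for
  distributivity: cancellation can make the support of a sum smaller than the union of the supports,
  so products are compared over one common set.\<close>

lemma basis_mult_superset:
  assumes "finite F" "finite F'" "Poly_Mapping.keys f \<subseteq> F" "Poly_Mapping.keys g \<subseteq> F'"
  shows "f \<otimes>\<^bsub>basis_algebra S m u\<^esub> g =
    (\<Sum>x\<in>F. \<Sum>y\<in>F'. opt_single (m x y) (Poly_Mapping.lookup f x * Poly_Mapping.lookup g y))"
proof -
  have "(\<Sum>y\<in>Poly_Mapping.keys g. opt_single (m x y) (a * Poly_Mapping.lookup g y)) =
      (\<Sum>y\<in>F'. opt_single (m x y) (a * Poly_Mapping.lookup g y))" for x a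
    using assms by (intro sum.mono_neutral_left) (auto simp: in_keys_iff)
  moreover have "(\<Sum>x\<in>Poly_Mapping.keys f. \<Sum>y\<in>F'. opt_single (m x y) (Poly_Mapping.lookup f x * Poly_Mapping.lookup g y)) =
      (\<Sum>x\<in>F. \<Sum>y\<in>F'. opt_single (m x y) (Poly_Mapping.lookup f x * Poly_Mapping.lookup g y))"
    using assms by (intro sum.mono_neutral_left) (auto simp: in_keys_iff)
  ultimately show ?thesis
    by (simp add: basis_mult_def)
qed

lemma basis_mult_single:
  "Poly_Mapping.single x a \<otimes>\<^bsub>basis_algebra S m u\<^esub> Poly_Mapping.single y b = opt_single (m x y) (a * b)"
  by (subst basis_mult_superset[where F = "{x}" and F' = "{y}"]) auto

lemma basis_mult_add_left:
  "(f + f') \<otimes>\<^bsub>basis_algebra S m u\<^esub> g =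
    f \<otimes>\<^bsub>basis_algebra S m u\<^esub> g + f' \<otimes>\<^bsub>basis_algebra S m u\<^esub> g"
proof -
  let ?F = "Poly_Mapping.keys f \<union> Poly_Mapping.keys f'"
  note s = basis_mult_superset[where F = ?F and F' = "Poly_Mapping.keys g"]
  have "Poly_Mapping.keys (f + f') \<subseteq> ?F" by (rule keys_add)
  then show ?thesis
    by (simp add: s lookup_add distrib_right opt_single_add sum.distrib)
qed

lemma basis_mult_add_right:
  "g \<otimes>\<^bsub>basis_algebra S m u\<^esub> (f + f') =
    g \<otimes>\<^bsub>basis_algebra S m u\<^esub> f + g \<otimes>\<^bsub>basis_algebra S m u\<^esub> f'"
proof -
  let ?F = "Poly_Mapping.keys f \<union> Poly_Mapping.keys f'"
  note s = basis_mult_superset[where F' = ?F and F = "Poly_Mapping.keys g"]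
  have "Poly_Mapping.keys (f + f') \<subseteq> ?F" by (rule keys_add)
  then show ?thesis
    by (simp add: s lookup_add distrib_left opt_single_add sum.distrib)
qed

lemma basis_mult_zero [simp]:
  "0 \<otimes>\<^bsub>basis_algebra S m u\<^esub> g = 0" "g \<otimes>\<^bsub>basis_algebra S m u\<^esub> 0 = 0"
  by (simp_all add: basis_mult_def)

lemma basis_mult_sum_left:
  "(\<Sum>i\<in>X. f i) \<otimes>\<^bsub>basis_algebra S m u\<^esub> g = (\<Sum>i\<in>X. f i \<otimes>\<^bsub>basis_algebra S m u\<^esub> g)"
  by (induction X rule: infinite_finite_induct) (simp_all add: basis_mult_add_left)

lemma basis_mult_sum_right:
  "g \<otimes>\<^bsub>basis_algebra S m u\<^esub> (\<Sum>i\<in>X. f i) = (\<Sum>i\<in>X. g \<otimes>\<^bsub>basis_algebra S m u\<^esub> f i)"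
  by (induction X rule: infinite_finite_induct) (simp_all add: basis_mult_add_right)

lemma keys_sum_subset:
  "(\<And>i. i \<in> X \<Longrightarrow> Poly_Mapping.keys (f i) \<subseteq> S) \<Longrightarrow> Poly_Mapping.keys (sum f X) \<subseteq> S"
proof (induction X rule: infinite_finite_induct)
  case (insert x F)
  then show ?case using keys_add[of "f x" "sum f F"] by auto
qed auto

lemma basis_mult_scale_left:
  "Poly_Mapping.map ((*) c) f \<otimes>\<^bsub>basis_algebra S m u\<^esub> g = Poly_Mapping.map ((*) c) (f \<otimes>\<^bsub>basis_algebra S m u\<^esub> g)"
proof -
  have "Poly_Mapping.keys (Poly_Mapping.map ((*) c) f) \<subseteq> Poly_Mapping.keys f"
    by (auto simp: in_keys_iff)
  then show ?thesis
    by (simp add: basis_mult_superset[where F = "Poly_Mapping.keys f" and F' = "Poly_Mapping.keys g"]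
      scale_sum mult.assoc)
qed

lemma basis_mult_scale_right:
  "f \<otimes>\<^bsub>basis_algebra S m u\<^esub> Poly_Mapping.map ((*) c) g = Poly_Mapping.map ((*) c) (f \<otimes>\<^bsub>basis_algebra S m u\<^esub> g)"
proof -
  have "Poly_Mapping.keys (Poly_Mapping.map ((*) c) g) \<subseteq> Poly_Mapping.keys g"
    by (auto simp: in_keys_iff)
  then show ?thesis
    by (simp add: basis_mult_superset[where F = "Poly_Mapping.keys f" and F' = "Poly_Mapping.keys g"]
      scale_sum mult.left_commute)
qed

section \<open>From laws on basis elements to a unital associative algebra\<close>

text \<open>Covers both words under concatenation and arrows of a groupoid. In
  \<open>op_assoc\<close>, \<open>Option.bind\<close> propagates undefinedness, so the two
  bracketings are defined simultaneously and agree. The unit laws are required on basis elements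
  only, since linearity extends them.\<close>

locale partial_basis =
  fixes S :: "'s set" and m :: "'s \<Rightarrow> 's \<Rightarrow> 's option" and u :: "'s \<Rightarrow>\<^sub>0 complex"
  assumes op_closed: "\<lbrakk>x \<in> S; y \<in> S; m x y = Some z\<rbrakk> \<Longrightarrow> z \<in> S"
    and op_assoc: "\<lbrakk>x \<in> S; y \<in> S; z \<in> S\<rbrakk> \<Longrightarrow>
      Option.bind (m x y) (\<lambda>w. m w z) = Option.bind (m y z) (m x)"
    and u_closed: "Poly_Mapping.keys u \<subseteq> S"
    and u_left: "x \<in> S \<Longrightarrow> u \<otimes>\<^bsub>basis_algebra S m u\<^esub> basis_elem x = basis_elem x"
    and u_right: "x \<in> S \<Longrightarrow> basis_elem x \<otimes>\<^bsub>basis_algebra S m u\<^esub> u = basis_elem x"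
begin

abbreviation alg :: "(complex, 's \<Rightarrow>\<^sub>0 complex) module" where
  "alg \<equiv> basis_algebra S m u"

lemma mult_closed:
  assumes "Poly_Mapping.keys f \<subseteq> S" "Poly_Mapping.keys g \<subseteq> S"
  shows "Poly_Mapping.keys (f \<otimes>\<^bsub>alg\<^esub> g) \<subseteq> S"
  unfolding basis_mult_def
proof (intro keys_sum_subset)
  fix x y assume "x \<in> Poly_Mapping.keys f" "y \<in> Poly_Mapping.keys g"
  then have "x \<in> S" "y \<in> S" using assms by auto
  from op_closed[OF this]
  show "Poly_Mapping.keys (opt_single (m x y) (Poly_Mapping.lookup f x * Poly_Mapping.lookup g y)) \<subseteq> S"
    by (cases "m x y") auto
qed

text \<open>An undefined product contributes 0 on either side, so \<open>op_assoc\<close> settles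
  every case. The coefficients are kept flexible to absorb scalars collected by earlier
  multiplications.\<close>

lemma single_assoc:
  assumes "x \<in> S" "y \<in> S" "z \<in> S" and "a * b = a' * b'"
  shows "opt_single (m x y) a \<otimes>\<^bsub>alg\<^esub> Poly_Mapping.single z b = Poly_Mapping.single x a' \<otimes>\<^bsub>alg\<^esub> opt_single (m y z) b'"
  using op_assoc[OF assms(1-3)] assms(4)
  by (cases "m x y"; cases "m y z") (simp_all add: basis_mult_single)

text \<open>Both sides are additive in each factor, so one induction per factor reduces the claim to
  \<open>single_assoc\<close>.\<close>

lemma mult_assoc:
  assumes "Poly_Mapping.keys f \<subseteq> S" "Poly_Mapping.keys g \<subseteq> S" "Poly_Mapping.keys h \<subseteq> S"
  shows "(f \<otimes>\<^bsub>alg\<^esub> g) \<otimes>\<^bsub>alg\<^esub> h = f \<otimes>\<^bsub>alg\<^esub> (g \<otimes>\<^bsub>alg\<^esub> h)"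
  using assms(1)
proof (induction f rule: keys_subset_induct)
  case (add f x a)
  have "(Poly_Mapping.single x a \<otimes>\<^bsub>alg\<^esub> g) \<otimes>\<^bsub>alg\<^esub> h = Poly_Mapping.single x a \<otimes>\<^bsub>alg\<^esub> (g \<otimes>\<^bsub>alg\<^esub> h)"
    using assms(2)
  proof (induction g rule: keys_subset_induct)
    case (add g y b)
    have "(Poly_Mapping.single x a \<otimes>\<^bsub>alg\<^esub> Poly_Mapping.single y b) \<otimes>\<^bsub>alg\<^esub> h =
        Poly_Mapping.single x a \<otimes>\<^bsub>alg\<^esub> (Poly_Mapping.single y b \<otimes>\<^bsub>alg\<^esub> h)"
      using assms(3)
    proof (induction h rule: keys_subset_induct)
      case (add h z c)
      then show ?case
        using single_assoc[OF \<open>x \<in> S\<close> \<open>y \<in> S\<close> \<open>z \<in> S\<close>, of "a * b" c a "b * c"]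
        by (simp add: basis_mult_add_right basis_mult_single mult.assoc)
    qed simp
    with add show ?case by (simp add: basis_mult_add_right basis_mult_add_left)
  qed simp
  with add show ?case by (simp add: basis_mult_add_left)
qed simp

lemma mult_u:
  assumes "Poly_Mapping.keys f \<subseteq> S"
  shows "u \<otimes>\<^bsub>alg\<^esub> f = f" "f \<otimes>\<^bsub>alg\<^esub> u = f"
  using assms
proof (induction f rule: keys_subset_induct)
  case (add p x c)
  have "u \<otimes>\<^bsub>alg\<^esub> Poly_Mapping.single x c = Poly_Mapping.single x c"
    "Poly_Mapping.single x c \<otimes>\<^bsub>alg\<^esub> u = Poly_Mapping.single x c"
    using basis_mult_scale_right[where f = u and c = c and g = "basis_elem x" and S = S and m = m and u = u]
      basis_mult_scale_left[where g = u and c = c and f = "basis_elem x" and S = S and m = m and u = u]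
      u_left u_right \<open>x \<in> S\<close> by simp_all
  note this[simp]
  { case 1 show ?case using add by (simp add: basis_mult_add_right) }
  { case 2 show ?case using add by (simp add: basis_mult_add_left) }
qed simp_all

sublocale complex_algebra alg
proof (intro complex_algebra.intro complex_algebra_axioms.intro ringI abelian_groupI monoidI)
  fix x assume "x \<in> carrier alg"
  then show "\<exists>y\<in>carrier alg. y \<oplus>\<^bsub>alg\<^esub> x = \<zero>\<^bsub>alg\<^esub>"
    by (intro bexI[of _ "- x"]) auto
next
  fix c x assume "x \<in> carrier alg"
  then show "c \<odot>\<^bsub>alg\<^esub> x \<in> carrier alg"
    by (auto simp: in_keys_iff subset_iff)
next
  fix a b x
  show "(a + b) \<odot>\<^bsub>alg\<^esub> x = a \<odot>\<^bsub>alg\<^esub> x \<oplus>\<^bsub>alg\<^esub> b \<odot>\<^bsub>alg\<^esub> x"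
    by (auto intro: poly_mapping_eqI simp: lookup_add distrib_right)
next
  fix a b x
  show "(a * b) \<odot>\<^bsub>alg\<^esub> x = a \<odot>\<^bsub>alg\<^esub> (b \<odot>\<^bsub>alg\<^esub> x)" "1 \<odot>\<^bsub>alg\<^esub> x = x"
    by (auto intro: poly_mapping_eqI)
next
  fix x y assume "x \<in> carrier alg" "y \<in> carrier alg"
  then show "x \<oplus>\<^bsub>alg\<^esub> y \<in> carrier alg"
    using keys_add[of x y] by auto
qed (simp_all add: mult_closed u_closed mult_assoc mult_u add_ac scale_add
    basis_mult_add_left basis_mult_add_right basis_mult_scale_left basis_mult_scale_right)

lemma algebra_hom_eqI:
  assumes "complex_algebra R" "h \<in> algebra_hom alg R" "k \<in> algebra_hom alg R"
    and eq: "\<And>x. x \<in> S \<Longrightarrow> h (basis_elem x) = k (basis_elem x)" and "Poly_Mapping.keys p \<subseteq> S"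
  shows "h p = k p"
  using assms(5)
proof (induction p rule: keys_subset_induct)
  case zero
  show ?case
    using algebra_hom_zero[OF assms(2) complex_algebra_axioms assms(1)]
      algebra_hom_zero[OF assms(3) complex_algebra_axioms assms(1)] by simp
next
  case (add p x c)
  have s: "p + Poly_Mapping.single x c = p \<oplus>\<^bsub>alg\<^esub> (c \<odot>\<^bsub>alg\<^esub> basis_elem x)" by simp
  have c: "p \<in> carrier alg" "basis_elem x \<in> carrier alg" using add by auto
  then show ?case
    unfolding s using assms(2,3) add eq
    by (simp only: algebra_homD smult_closed)
qed

end

section \<open>Linear extension of maps defined on a basis\<close>

definition lin_ext :: "(complex, 'b) module \<Rightarrow> ('s \<Rightarrow> 'b) \<Rightarrow> ('s \<Rightarrow>\<^sub>0 complex) \<Rightarrow> 'b" where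
  "lin_ext R f p = (\<Oplus>\<^bsub>R\<^esub>x\<in>Poly_Mapping.keys p. Poly_Mapping.lookup p x \<odot>\<^bsub>R\<^esub> f x)"

context complex_algebra
begin

lemma lin_ext_superset:
  assumes "f \<in> F \<rightarrow> carrier R" "finite F" "Poly_Mapping.keys p \<subseteq> F"
  shows "lin_ext R f p = (\<Oplus>x\<in>F. Poly_Mapping.lookup p x \<odot> f x)"
  unfolding lin_ext_def using assms
  by (intro add.finprod_mono_neutral_cong_left) (auto simp: in_keys_iff Pi_iff)

lemma lin_ext_zero [simp]: "lin_ext R f 0 = \<zero>"
  by (simp add: lin_ext_def)

lemma lin_ext_closed:
  "f \<in> S \<rightarrow> carrier R \<Longrightarrow> Poly_Mapping.keys p \<subseteq> S \<Longrightarrow> lin_ext R f p \<in> carrier R"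
  unfolding lin_ext_def by (rule finsum_closed) auto

lemma lin_ext_single:
  "f x \<in> carrier R \<Longrightarrow> lin_ext R f (Poly_Mapping.single x c) = c \<odot> f x"
  by (subst lin_ext_superset[where F = "{x}"]) auto

lemma lin_ext_add:
  assumes "f \<in> S \<rightarrow> carrier R" "Poly_Mapping.keys p \<subseteq> S" "Poly_Mapping.keys q \<subseteq> S"
  shows "lin_ext R f (p + q) = lin_ext R f p \<oplus> lin_ext R f q"
proof -
  let ?F = "Poly_Mapping.keys p \<union> Poly_Mapping.keys q"
  have F: "f \<in> ?F \<rightarrow> carrier R" using assms by auto
  then have c: "(\<lambda>x. r x \<odot> f x) \<in> ?F \<rightarrow> carrier R" for r by auto
  have "lin_ext R f (p + q) = (\<Oplus>x\<in>?F. Poly_Mapping.lookup (p + q) x \<odot> f x)"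
    by (rule lin_ext_superset[OF F]) (simp_all add: keys_add)
  also have "\<dots> = (\<Oplus>x\<in>?F. Poly_Mapping.lookup p x \<odot> f x \<oplus> Poly_Mapping.lookup q x \<odot> f x)"
    using F by (intro finsum_cong') (auto simp: lookup_add smult_l_distr Pi_iff)
  also have "\<dots> = lin_ext R f p \<oplus> lin_ext R f q"
    using F c by (simp add: finsum_addf lin_ext_superset[where F = ?F])
  finally show ?thesis .
qed

lemma lin_ext_scale:
  assumes "f \<in> S \<rightarrow> carrier R" "Poly_Mapping.keys p \<subseteq> S"
  shows "lin_ext R f (Poly_Mapping.map ((*) c) p) = c \<odot> lin_ext R f p"
  using assms(2)
proof (induction p rule: keys_subset_induct)
  case (add p x a)
  have k: "Poly_Mapping.keys (Poly_Mapping.map ((*) c) p) \<subseteq> S"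
    using add by (auto simp: in_keys_iff subset_iff)
  have fx: "f x \<in> carrier R" using add assms by auto
  show ?case
    using add k fx lin_ext_closed[OF assms(1), of p]
    by (simp add: scale_add lin_ext_add[OF assms(1)] lin_ext_single smult_r_distr smult_assoc)
qed simp

lemma lin_ext_sum:
  assumes "f \<in> S \<rightarrow> carrier R" "finite X" "k ` X \<subseteq> S"
  shows "lin_ext R f (\<Sum>i\<in>X. basis_elem (k i)) = (\<Oplus>i\<in>X. f (k i))"
  using assms(2,3)
proof (induction X rule: finite_induct)
  case (insert x F)
  have "Poly_Mapping.keys (\<Sum>i\<in>F. basis_elem (k i)) \<subseteq> S"
    using insert by (intro keys_sum_subset) auto
  moreover have "f (k x) \<in> carrier R" "(\<lambda>i. f (k i)) \<in> F \<rightarrow> carrier R"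
    using insert assms(1) by auto
  ultimately show ?case
    using insert by (simp add: lin_ext_add[OF assms(1)] lin_ext_single)
qed simp

text \<open>Both sides of the multiplicativity law are bilinear, so two nested inductions leave only
  products of basis elements, where it is the hypothesis \<open>mult\<close>. The condition on
  \<open>u\<close> is separate because \<open>u\<close> may be a sum of several basis
  elements.\<close>

lemma lin_ext_algebra_hom:
  assumes f: "f \<in> S \<rightarrow> carrier R"
    and mult: "\<And>x y. \<lbrakk>x \<in> S; y \<in> S\<rbrakk> \<Longrightarrow> f x \<otimes> f y = (case m x y of None \<Rightarrow> \<zero> | Some z \<Rightarrow> f z)"
    and one: "lin_ext R f u = \<one>"
    and "partial_basis S m u"
  shows "lin_ext R f \<in> algebra_hom (basis_algebra S m u) R"
proof -
  interpret B: partial_basis S m u by fact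
  note cl = lin_ext_closed[OF f]
  note fc = funcset_mem[OF f]
  have M: "lin_ext R f (p \<otimes>\<^bsub>B.alg\<^esub> q) = lin_ext R f p \<otimes> lin_ext R f q"
    if "Poly_Mapping.keys p \<subseteq> S" and q: "Poly_Mapping.keys q \<subseteq> S" for p q
    using that(1)
  proof (induction p rule: keys_subset_induct)
    case zero
    then show ?case using cl[OF q] by simp
  next
    case (add p x a)
    have "lin_ext R f (Poly_Mapping.single x a \<otimes>\<^bsub>B.alg\<^esub> q) = lin_ext R f (Poly_Mapping.single x a) \<otimes> lin_ext R f q"
      using q
    proof (induction q rule: keys_subset_induct)
      case zero
      then show ?case using fc[OF add(2)] by (simp add: lin_ext_single)
    next
      case (add q y b)
      have "lin_ext R f (opt_single (m x y) (a * b)) = (a * b) \<odot> (f x \<otimes> f y)"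
        using mult[OF \<open>x \<in> S\<close> \<open>y \<in> S\<close>] B.op_closed[OF \<open>x \<in> S\<close> \<open>y \<in> S\<close>] fc
        by (cases "m x y") (auto simp: lin_ext_single)
      moreover have "Poly_Mapping.keys (opt_single (m x y) (a * b)) \<subseteq> S"
        using B.op_closed[OF \<open>x \<in> S\<close> \<open>y \<in> S\<close>] by (cases "m x y") auto
      moreover have "Poly_Mapping.keys (Poly_Mapping.single x a \<otimes>\<^bsub>B.alg\<^esub> q) \<subseteq> S"
        using add \<open>x \<in> S\<close> by (intro B.mult_closed) auto
      ultimately show ?case
        using add \<open>x \<in> S\<close> fc cl[of q]
        by (simp add: basis_mult_add_right basis_mult_single lin_ext_add[OF f] lin_ext_single
            smult_mult_smult r_distr)
    qed
    moreover have "Poly_Mapping.keys (Poly_Mapping.single x a \<otimes>\<^bsub>B.alg\<^esub> q) \<subseteq> S"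
      "Poly_Mapping.keys (p \<otimes>\<^bsub>B.alg\<^esub> q) \<subseteq> S"
      using add q by (intro B.mult_closed; auto)+
    ultimately show ?case
      using add q fc cl
      by (simp add: basis_mult_add_left lin_ext_add[OF f] lin_ext_single l_distr)
  qed
  show ?thesis
    using cl M one lin_ext_add[OF f] lin_ext_scale[OF f] by (intro algebra_homI) auto
qed

end

subsection \<open>Quotients\<close>

lemma quotient_algebra_simps:
  "carrier (quotient_algebra R I) = carrier (R Quot I)"
  "mult (quotient_algebra R I) = mult (R Quot I)"
  "one (quotient_algebra R I) = one (R Quot I)"
  "zero (quotient_algebra R I) = zero (R Quot I)"
  "add (quotient_algebra R I) = add (R Quot I)"
  by (simp_all add: quotient_algebra_def)

context complex_algebra
begin

context
  fixes I assumes I: "ideal I R"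
begin

interpretation I: ideal I R by (rule I)

lemma carrier_quotient: "carrier (quotient_algebra R I) = (\<lambda>x. I +> x) ` carrier R"
  by (auto simp: quotient_algebra_simps FactRing_def A_RCOSETS_defs a_r_coset_def)

lemma coset_eqI:
  assumes "x \<in> carrier R" "y \<in> carrier R" "x \<ominus> y \<in> I"
  shows "I +> x = I +> y"
  using quotient_eq_iff_same_a_r_cos[OF I assms(1,2)] assms(3) by simp

lemma coset_algebra_ops:
  assumes "x \<in> carrier R" "y \<in> carrier R"
  shows "(I +> x) \<otimes>\<^bsub>quotient_algebra R I\<^esub> (I +> y) = I +> (x \<otimes> y)"
    and "(I +> x) \<oplus>\<^bsub>quotient_algebra R I\<^esub> (I +> y) = I +> (x \<oplus> y)"
    and "c \<odot>\<^bsub>quotient_algebra R I\<^esub> (I +> x) = I +> (c \<odot> x)"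
proof -
  show "(I +> x) \<otimes>\<^bsub>quotient_algebra R I\<^esub> (I +> y) = I +> (x \<otimes> y)"
    using assms by (simp add: quotient_algebra_simps FactRing_def I.rcoset_mult_add)
  show "(I +> x) \<oplus>\<^bsub>quotient_algebra R I\<^esub> (I +> y) = I +> (x \<oplus> y)"
    using assms by (simp add: quotient_algebra_simps FactRing_def I.a_rcos_sum)
  \<comment> \<open>The scalar action on a coset is a union over all representatives. They all yield
    the same coset, since \<open>c\<close> times an element of \<open>I\<close> stays in
    \<open>I\<close>, so the union is that single coset.\<close>
  have "I +> (c \<odot> a) = I +> (c \<odot> x)" if a: "a \<in> I +> x" for a
  proof -
    obtain i where i: "i \<in> I" "a = i \<oplus> x"
      using a by (auto simp: a_r_coset_def')
    then have ic: "i \<in> carrier R" using I.a_Hcarr by blast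
    have "(c \<odot> a) \<ominus> (c \<odot> x) = c \<odot> i"
      using assms ic i(2) by (simp add: smult_r_distr a_minus_def add.m_assoc r_neg)
    then show ?thesis
      using i ic assms ideal_smult_closed[OF I i(1)] by (intro coset_eqI) auto
  qed
  moreover have "I +> x \<noteq> {}" using I.a_rcos_self assms by blast
  ultimately have "(\<Union>a\<in>I +> x. I +> (c \<odot> a)) = I +> (c \<odot> x)"
    by (intro SUP_eq_const)
  then show "c \<odot>\<^bsub>quotient_algebra R I\<^esub> (I +> x) = I +> (c \<odot> x)"
    by (simp add: quotient_algebra_def)
qed

lemma quotient_complex_algebra: "complex_algebra (quotient_algebra R I)"
proof (intro complex_algebra.intro complex_algebra_axioms.intro)
  interpret Q: ring "R Quot I" by (rule I.quotient_is_ring)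
  show "ring (quotient_algebra R I)"
  proof (intro ringI abelian_groupI monoidI)
    fix x assume "x \<in> carrier (quotient_algebra R I)"
    then show "\<exists>y\<in>carrier (quotient_algebra R I).
        y \<oplus>\<^bsub>quotient_algebra R I\<^esub> x = \<zero>\<^bsub>quotient_algebra R I\<^esub>"
      using Q.l_neg by (auto simp: quotient_algebra_simps)
  qed (simp_all add: quotient_algebra_simps Q.m_assoc Q.a_assoc Q.a_comm Q.a_lcomm Q.l_distr Q.r_distr)
qed (auto simp: carrier_quotient coset_algebra_ops smult_l_distr smult_r_distr smult_assoc
    smult_mult_l smult_mult_r)

lemma coset_algebra_hom: "(\<lambda>x. I +> x) \<in> algebra_hom R (quotient_algebra R I)"
  by (rule algebra_homI)
    (auto simp: carrier_quotient coset_algebra_ops quotient_algebra_simps(3) FactRing_def)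

text \<open>Universal property of the quotient by an ideal that \<open>h\<close>
  annihilates.\<close>

lemma quotient_lift:
  assumes "complex_algebra S" and h: "h \<in> algebra_hom R S" and "\<And>x. x \<in> I \<Longrightarrow> h x = \<zero>\<^bsub>S\<^esub>"
  shows "\<exists>k \<in> algebra_hom (quotient_algebra R I) S. \<forall>x\<in>carrier R. k (I +> x) = h x"
proof -
  interpret S: complex_algebra S by fact
  \<comment> \<open>\<open>h\<close> is constant on each coset, so the image is a singleton and no
    representative has to be chosen.\<close>
  define k where "k X = the_elem (h ` X)" for X
  have k: "k (I +> x) = h x" if x: "x \<in> carrier R" for x
  proof -
    have "h a = h x" if a: "a \<in> I +> x" for a
    proof -
      obtain i where i: "i \<in> I" "a = i \<oplus> x"
        using a by (auto simp: a_r_coset_def')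
      then show ?thesis
        using assms(3) I.a_Hcarr x algebra_homD[OF h] by fastforce
    qed
    moreover have "x \<in> I +> x" using I.a_rcos_self x by blast
    ultimately have "h ` (I +> x) = {h x}" by blast
    then show ?thesis by (simp add: k_def)
  qed
  have o: "\<one>\<^bsub>quotient_algebra R I\<^esub> = I +> \<one>"
    by (simp add: quotient_algebra_simps(3) FactRing_def)
  have "k \<in> algebra_hom (quotient_algebra R I) S"
    by (rule algebra_homI) (auto simp: carrier_quotient coset_algebra_ops k o algebra_homD[OF h])
  then show ?thesis using k by blast
qed

end

end

subsection \<open>Products of commuting families\<close>

context monoid
begin

context
  fixes f :: "'i \<Rightarrow> 'a" and B :: "'i set"
  assumes f: "f \<in> B \<rightarrow> carrier G"
    and comm: "\<And>x y. \<lbrakk>x \<in> B; y \<in> B\<rbrakk> \<Longrightarrow> f x \<otimes> f y = f y \<otimes> f x"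
begin

text \<open>\<open>finprod\<close> folds left multiplications. These commute as maps as soon as the
  factors commute, which makes the fold independent of the order even in a noncommutative
  monoid.\<close>

interpretation LCD B "carrier G" "mult G \<circ> f"
proof
  fix x y z assume xyz: "x \<in> B" "y \<in> B" "z \<in> carrier G"
  then have "f x \<in> carrier G" "f y \<in> carrier G" using f by auto
  then show "(mult G \<circ> f) x ((mult G \<circ> f) y z) = (mult G \<circ> f) y ((mult G \<circ> f) x z)"
    using xyz comm[of x y] by (simp flip: m_assoc)
qed (use f in auto)

lemma finprod_commuting_empty: "finprod G f {} = \<one>"
  by (simp add: finprod_def)

lemma finprod_commuting_insert:
  "\<lbrakk>finite A; a \<notin> A; insert a A \<subseteq> B\<rbrakk> \<Longrightarrow> finprod G f (insert a A) = f a \<otimes> finprod G f A"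
  using foldD_insert[of A a \<one>] by (simp add: finprod_def)

lemma finprod_commuting_closed: "A \<subseteq> B \<Longrightarrow> finprod G f A \<in> carrier G"
  by (simp add: finprod_def)

text \<open>Moving \<open>z\<close> past one factor at a time relabels each factor by
  \<open>h\<close>; injectivity prevents two factors from merging in the image. It is applied with
  \<open>h\<close> a translation of the group and, for plain commutation, with \<open>h\<close> the
  identity.\<close>

lemma finprod_commuting_intertwine:
  assumes "finite A" "A \<subseteq> B" "h ` A \<subseteq> B" "inj_on h A" "z \<in> carrier G"
    and "\<And>a. a \<in> A \<Longrightarrow> z \<otimes> f a = f (h a) \<otimes> z"
  shows "z \<otimes> finprod G f A = finprod G f (h ` A) \<otimes> z"
  using assms(1,2,3,4,6)
proof (induction A rule: finite_induct)
  case (insert a A)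
  have c: "f a \<in> carrier G" "f (h a) \<in> carrier G" "finprod G f A \<in> carrier G" "finprod G f (h ` A) \<in> carrier G"
    using f insert.prems by (auto intro: finprod_commuting_closed)
  have "z \<otimes> finprod G f (insert a A) = (z \<otimes> f a) \<otimes> finprod G f A"
    using insert.hyps insert.prems(1) c assms(5) by (simp add: finprod_commuting_insert m_assoc)
  also have "\<dots> = f (h a) \<otimes> (z \<otimes> finprod G f A)"
    using insert.prems c assms(5) by (simp add: m_assoc)
  also have "\<dots> = (f (h a) \<otimes> finprod G f (h ` A)) \<otimes> z"
    using insert c assms(5) by (simp add: m_assoc)
  also have "f (h a) \<otimes> finprod G f (h ` A) = finprod G f (h ` insert a A)"
    using insert by (simp add: finprod_commuting_insert)
  finally show ?case .
qed (use assms(5) in \<open>simp add: finprod_commuting_empty\<close>)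

lemma finprod_commuting_commute:
  assumes "finite A" "A \<subseteq> B" "z \<in> carrier G"
    and "\<And>a. a \<in> A \<Longrightarrow> z \<otimes> f a = f a \<otimes> z"
  shows "z \<otimes> finprod G f A = finprod G f A \<otimes> z"
  using finprod_commuting_intertwine[where h = "\<lambda>x. x"] assms by simp

lemma finprod_commuting_absorb:
  assumes "finite A" "A \<subseteq> B" "z \<in> carrier G"
    and "\<And>a. a \<in> A \<Longrightarrow> z \<otimes> f a = z"
  shows "z \<otimes> finprod G f A = z"
  using assms(1,2,4)
proof (induction A rule: finite_induct)
  case (insert a A)
  have "f a \<in> carrier G" "finprod G f A \<in> carrier G"
    using f insert.prems by (auto intro: finprod_commuting_closed)
  then show ?case
    using insert assms(3) by (simp add: finprod_commuting_insert m_assoc[symmetric])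
qed (use assms(3) in \<open>simp add: finprod_commuting_empty\<close>)

lemma finprod_commuting_remove:
  assumes "finite A" "A \<subseteq> B" "a \<in> A"
  shows "finprod G f A = f a \<otimes> finprod G f (A - {a})"
  using finprod_commuting_insert[of "A - {a}" a] assms by (simp add: insert_absorb)

end

end

text \<open>The images commute because the factors do, so the insertion rule for
  \<open>finprod\<close> is available in both rings.\<close>

lemma ring_hom_finprod_commuting:
  assumes "ring R" "ring S" "h \<in> ring_hom R S" "finite A" "f \<in> A \<rightarrow> carrier R"
    and comm: "\<And>x y. \<lbrakk>x \<in> A; y \<in> A\<rbrakk> \<Longrightarrow> f x \<otimes>\<^bsub>R\<^esub> f y = f y \<otimes>\<^bsub>R\<^esub> f x"
    and g: "\<And>x. x \<in> A \<Longrightarrow> g x = h (f x)"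
  shows "h (finprod R f A) = finprod S g A"
proof -
  interpret R: ring R by fact
  interpret S: ring S by fact
  have c: "g \<in> A \<rightarrow> carrier S"
    using assms(3,5) by (auto simp: g ring_hom_closed Pi_iff)
  have hc: "g x \<otimes>\<^bsub>S\<^esub> g y = g y \<otimes>\<^bsub>S\<^esub> g x" if "x \<in> A" "y \<in> A" for x y
    using comm[OF that] ring_hom_mult[OF assms(3), symmetric] funcset_mem[OF assms(5)] that by (simp add: g)
  \<comment> \<open>The induction runs over subsets of the fixed set \<open>A\<close>, so that the
    commutation hypotheses on \<open>A\<close> remain usable.\<close>
  have "F \<subseteq> A \<Longrightarrow> h (finprod R f F) = finprod S g F" if "finite F" for F
    using that
  proof (induction F rule: finite_induct)
    case empty
    then show ?case
      using assms(3) by (simp add: finprod_def ring_hom_one)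
  next
    case (insert a F)
    have "f a \<in> carrier R" "finprod R f F \<in> carrier R"
      using insert.prems assms(5) R.finprod_commuting_closed[OF assms(5) comm, of F] by auto
    then show ?case
      using insert R.finprod_commuting_insert[OF assms(5) comm, of F a]
        S.finprod_commuting_insert[OF c hc, of F a] assms(3)
      by (simp add: g ring_hom_mult)
  qed
  then show ?thesis using assms(4) by simp
qed

subsection \<open>Unions of cosets\<close>

lemma coset_unions_subset: "A \<in> coset_unions G H \<Longrightarrow> A \<subseteq> carrier G"
  by (simp add: coset_unions_def)

lemma finite_coset_unions: "finite (carrier G) \<Longrightarrow> finite (coset_unions G H)"
  by (rule finite_subset[of _ "Pow (carrier G)"]) (auto simp: coset_unions_def)

context
  fixes G :: "('a, 'm) monoid_scheme" (structure) and H
  assumes G: "group G" and H: "subgroup H G"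
begin

interpretation group G by (rule G)
interpretation H: subgroup H G by (rule H)

text \<open>A set is a union of left cosets exactly when it is stable under right multiplication by
  \<open>H\<close>. This elementwise form replaces the family of cosets in later arguments.\<close>

lemma coset_unions_iff:
  "A \<in> coset_unions G H \<longleftrightarrow>
    A \<subseteq> carrier G \<and> H \<subseteq> A \<and> (\<forall>a\<in>A. \<forall>h\<in>H. a \<otimes> h \<in> A)"
proof (intro iffI)
  assume "A \<in> coset_unions G H"
  then obtain C where A: "A \<subseteq> carrier G" "H \<subseteq> A" "C \<subseteq> lcosets H" "A = \<Union>C"
    by (auto simp: coset_unions_def)
  have "a \<otimes> h \<in> A" if "a \<in> A" "h \<in> H" for a h
  proof -
    obtain b where b: "b \<in> carrier G" "b <# H \<in> C" "a \<in> b <# H"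
      using A(3,4) \<open>a \<in> A\<close> unfolding LCOSETS_def by blast
    then obtain k where "k \<in> H" "a = b \<otimes> k"
      by (auto simp: l_coset_def)
    then have "a \<otimes> h \<in> b <# H"
      using b(1) that(2) by (auto simp: l_coset_def m_assoc)
    then show ?thesis using A(4) b(2) by blast
  qed
  with A show "A \<subseteq> carrier G \<and> H \<subseteq> A \<and> (\<forall>a\<in>A. \<forall>h\<in>H. a \<otimes> h \<in> A)" by blast
next
  assume A: "A \<subseteq> carrier G \<and> H \<subseteq> A \<and> (\<forall>a\<in>A. \<forall>h\<in>H. a \<otimes> h \<in> A)"
  \<comment> \<open>Each \<open>a\<close> lies in its own coset because \<open>H\<close> contains
    the neutral element, and stability keeps that coset inside \<open>A\<close>.\<close>
  then have "A = \<Union>((\<lambda>a. a <# H) ` A)"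
    using H.one_closed by (force simp: l_coset_def)
  moreover have "(\<lambda>a. a <# H) ` A \<subseteq> lcosets H"
    using A by (auto simp: LCOSETS_def)
  ultimately show "A \<in> coset_unions G H"
    unfolding coset_unions_def using A by blast
qed

lemma mem_translate_iff:
  assumes "A \<subseteq> carrier G" "g \<in> carrier G" "x \<in> carrier G"
  shows "x \<in> g <# A \<longleftrightarrow> inv g \<otimes> x \<in> A"
proof
  assume "x \<in> g <# A"
  then show "inv g \<otimes> x \<in> A"
    using assms by (auto simp: l_coset_def subset_iff m_assoc[symmetric])
next
  assume "inv g \<otimes> x \<in> A"
  moreover have "x = g \<otimes> (inv g \<otimes> x)"
    using assms by (simp add: m_assoc[symmetric])
  ultimately show "x \<in> g <# A"
    unfolding l_coset_def by blast
qed

lemma translate_image: "g <# A = (\<lambda>a. g \<otimes> a) ` A"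
  by (auto simp: l_coset_def)

lemma translate_Diff:
  assumes "A \<subseteq> carrier G" "g \<in> carrier G"
  shows "g <# (carrier G - A) = carrier G - (g <# A)"
proof (rule Set.set_eqI)
  fix x
  have "g <# (carrier G - A) \<subseteq> carrier G"
    using assms by (intro l_coset_subset_G) auto
  then show "x \<in> g <# (carrier G - A) \<longleftrightarrow> x \<in> carrier G - (g <# A)"
    using assms by (cases "x \<in> carrier G") (auto simp: mem_translate_iff)
qed

text \<open>Left translation preserves stability under right multiplication by \<open>H\<close>, and
  \<open>inv g \<in> A\<close> ensures that the translate still contains \<open>H\<close>. Thus the
  range of an arrow is an object of the groupoid.\<close>

lemma translate_coset_unions:
  assumes A: "A \<in> coset_unions G H" and g: "g \<in> carrier G" "inv g \<in> A"
  shows "g <# A \<in> coset_unions G H"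
proof -
  have A': "A \<subseteq> carrier G" "\<And>a h. \<lbrakk>a \<in> A; h \<in> H\<rbrakk> \<Longrightarrow> a \<otimes> h \<in> A"
    using A by (auto simp: coset_unions_iff)
  have "h \<in> g <# A" if "h \<in> H" for h
    using A' g that by (simp add: mem_translate_iff)
  moreover have "g <# A \<subseteq> carrier G"
    using A'(1) g(1) by (rule l_coset_subset_G)
  moreover have "x \<otimes> h \<in> g <# A" if "x \<in> g <# A" "h \<in> H" for x h
    using that A' g by (auto simp: l_coset_def subset_iff m_assoc)
  ultimately show ?thesis
    by (auto simp: coset_unions_iff)
qed

end

subsection \<open>Partial representations\<close>

text \<open>Both \<open>par_gen\<close> and \<open>mu_p\<close> will be instances, so consequences
  of the relations are derived once for both algebras. The relations involving the neutral generator
  are expressed by \<open>u_one\<close>.\<close>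

locale partial_rep = complex_algebra R + G: group G + H: subgroup H G
  for R :: "(complex, 'b) module" (structure) and G :: "('a, 'm) monoid_scheme" and H +
  fixes u :: "'a \<Rightarrow> 'b"
  assumes finite_G: "finite (carrier G)"
    and u_closed [simp]: "g \<in> carrier G \<Longrightarrow> u g \<in> carrier R"
    and u_one: "u \<one>\<^bsub>G\<^esub> = \<one>"
    and u_left: "\<lbrakk>g \<in> carrier G; g' \<in> carrier G\<rbrakk> \<Longrightarrow>
      u (inv\<^bsub>G\<^esub> g) \<otimes> u g \<otimes> u g' = u (inv\<^bsub>G\<^esub> g) \<otimes> u (g \<otimes>\<^bsub>G\<^esub> g')"
    and u_right: "\<lbrakk>g \<in> carrier G; g' \<in> carrier G\<rbrakk> \<Longrightarrow>
      u g' \<otimes> u g \<otimes> u (inv\<^bsub>G\<^esub> g) = u (g' \<otimes>\<^bsub>G\<^esub> g) \<otimes> u (inv\<^bsub>G\<^esub> g)"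
    and u_subgroup: "h \<in> H \<Longrightarrow> u h \<otimes> u (inv\<^bsub>G\<^esub> h) = \<one>"
begin

text \<open>\<open>e\<close> and \<open>P\<close> are the counterparts of \<open>par_idem\<close>
  and \<open>par_proj\<close> for an arbitrary partial representation.\<close>

definition e :: "'a \<Rightarrow> 'b" where
  "e g = u g \<otimes> u (inv\<^bsub>G\<^esub> g)"

definition P :: "'a set \<Rightarrow> 'b" where
  "P A = finprod R e A \<otimes> finprod R (\<lambda>g. \<one> \<ominus> e g) (carrier G - A)"

lemma e_closed [simp]: "g \<in> carrier G \<Longrightarrow> e g \<in> carrier R"
  by (simp add: e_def)

section \<open>Commutation rules for the idempotents\<close>

lemma u_inv_u: "g \<in> carrier G \<Longrightarrow> u g \<otimes> u (inv\<^bsub>G\<^esub> g) \<otimes> u g = u g"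
  using u_left[of "inv\<^bsub>G\<^esub> g" g] by (simp add: u_one)

lemma e_u: "g \<in> carrier G \<Longrightarrow> e g \<otimes> u g = u g"
  by (simp add: e_def u_inv_u)

lemma u_e_inv: "g \<in> carrier G \<Longrightarrow> u g \<otimes> e (inv\<^bsub>G\<^esub> g) = u g"
  by (simp add: e_def u_inv_u m_assoc[symmetric])

lemma e_idem: "g \<in> carrier G \<Longrightarrow> e g \<otimes> e g = e g"
  using e_u[of g] by (simp add: e_def m_assoc[symmetric])

text \<open>Inserting \<open>u (inv g) \<otimes> u g\<close> after \<open>u g\<close> allows
  \<open>u_left\<close> to merge the last two factors: \<open>u\<close> is multiplicative up to an
  idempotent.\<close>

lemma u_mult_left: "\<lbrakk>g \<in> carrier G; h \<in> carrier G\<rbrakk> \<Longrightarrow> u g \<otimes> u h = e g \<otimes> u (g \<otimes>\<^bsub>G\<^esub> h)"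
proof -
  assume gh: "g \<in> carrier G" "h \<in> carrier G"
  have "u g \<otimes> u h = u g \<otimes> (u (inv\<^bsub>G\<^esub> g) \<otimes> u g \<otimes> u h)"
    using gh by (simp add: m_assoc[symmetric] u_inv_u)
  also have "\<dots> = e g \<otimes> u (g \<otimes>\<^bsub>G\<^esub> h)"
    using gh by (simp add: u_left e_def m_assoc[symmetric])
  finally show ?thesis .
qed

lemma u_mult_right: "\<lbrakk>g \<in> carrier G; h \<in> carrier G\<rbrakk> \<Longrightarrow> u g \<otimes> u h = u (g \<otimes>\<^bsub>G\<^esub> h) \<otimes> e (inv\<^bsub>G\<^esub> h)"
proof -
  assume gh: "g \<in> carrier G" "h \<in> carrier G"
  have "u g \<otimes> u h = u g \<otimes> (u h \<otimes> u (inv\<^bsub>G\<^esub> h) \<otimes> u h)"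
    using gh by (simp add: u_inv_u)
  also have "\<dots> = (u g \<otimes> u h \<otimes> u (inv\<^bsub>G\<^esub> h)) \<otimes> u h"
    using gh by (simp add: m_assoc)
  also have "\<dots> = u (g \<otimes>\<^bsub>G\<^esub> h) \<otimes> e (inv\<^bsub>G\<^esub> h)"
    unfolding u_right[OF gh(2,1)] using gh by (simp add: e_def m_assoc)
  finally show ?thesis .
qed

text \<open>\<open>u_right\<close> merges \<open>u g \<otimes> u h\<close> in front of
  \<open>u (inv h)\<close>; \<open>u_mult_left\<close> then splits off an idempotent and cancels
  \<open>h\<close>. Conjugation by \<open>u g\<close> thus translates the index of
  \<open>e\<close>.\<close>

lemma u_e:
  assumes gh: "g \<in> carrier G" "h \<in> carrier G"
  shows "u g \<otimes> e h = e (g \<otimes>\<^bsub>G\<^esub> h) \<otimes> u g"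
proof -
  have "u g \<otimes> e h = u (g \<otimes>\<^bsub>G\<^esub> h) \<otimes> u (inv\<^bsub>G\<^esub> h)"
    using gh by (simp add: e_def m_assoc[symmetric] u_right)
  also have "\<dots> = e (g \<otimes>\<^bsub>G\<^esub> h) \<otimes> u (g \<otimes>\<^bsub>G\<^esub> h \<otimes>\<^bsub>G\<^esub> inv\<^bsub>G\<^esub> h)"
    using gh by (intro u_mult_left) auto
  also have "g \<otimes>\<^bsub>G\<^esub> h \<otimes>\<^bsub>G\<^esub> inv\<^bsub>G\<^esub> h = g"
    using gh by (simp add: G.m_assoc)
  finally show ?thesis .
qed

text \<open>Moving \<open>e h\<close> through the two halves of \<open>e g\<close> translates its
  index by \<open>inv g\<close> and then back by \<open>g\<close>.\<close>

lemma e_commute: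
  assumes gh: "g \<in> carrier G" "h \<in> carrier G"
  shows "e g \<otimes> e h = e h \<otimes> e g"
proof -
  have "e g \<otimes> e h = u g \<otimes> (u (inv\<^bsub>G\<^esub> g) \<otimes> e h)"
    using gh by (simp add: e_def m_assoc)
  also have "\<dots> = u g \<otimes> e (inv\<^bsub>G\<^esub> g \<otimes>\<^bsub>G\<^esub> h) \<otimes> u (inv\<^bsub>G\<^esub> g)"
    using gh by (simp add: u_e[of "inv\<^bsub>G\<^esub> g" h] m_assoc)
  also have "\<dots> = e h \<otimes> u g \<otimes> u (inv\<^bsub>G\<^esub> g)"
    using gh by (simp add: u_e G.m_assoc[symmetric])
  also have "\<dots> = e h \<otimes> e g"
    using gh by (simp add: e_def m_assoc)
  finally show ?thesis .
qed

lemma e_subgroup: "h \<in> H \<Longrightarrow> e h = \<one>"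
  by (simp add: e_def u_subgroup)

lemma u_mult_subgroup:
  "\<lbrakk>g \<in> carrier G; h \<in> H\<rbrakk> \<Longrightarrow> u g \<otimes> u h = u (g \<otimes>\<^bsub>G\<^esub> h)"
  "\<lbrakk>g \<in> carrier G; h \<in> H\<rbrakk> \<Longrightarrow> u h \<otimes> u g = u (h \<otimes>\<^bsub>G\<^esub> g)"
  using u_mult_right[of g h] u_mult_left[of h g] e_subgroup[of h] e_subgroup[of "inv\<^bsub>G\<^esub> h"]
  by auto

text \<open>Expanding the left side leaves \<open>e h = \<one>\<close> in the middle. As a result
  \<open>e\<close> is constant on left cosets of \<open>H\<close>, which forces the index sets of
  nonzero projections to be unions of cosets.\<close>

lemma e_mult_subgroup:
  assumes "g \<in> carrier G" "h \<in> H"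
  shows "e (g \<otimes>\<^bsub>G\<^esub> h) = e g"
proof -
  have h: "h \<in> carrier G" using assms by simp
  have "e (g \<otimes>\<^bsub>G\<^esub> h) = (u g \<otimes> u h) \<otimes> (u (inv\<^bsub>G\<^esub> h) \<otimes> u (inv\<^bsub>G\<^esub> g))"
    using assms h by (simp add: e_def u_mult_subgroup G.inv_mult_group)
  also have "\<dots> = u g \<otimes> e h \<otimes> u (inv\<^bsub>G\<^esub> g)"
    using assms h by (simp add: e_def m_assoc)
  finally show ?thesis
    using assms by (simp add: e_subgroup) (simp add: e_def)
qed

abbreviation "ce g \<equiv> \<one> \<ominus> e g"

text \<open>Intertwining is linear and always holds for \<open>\<one>\<close>, so every rule for
  \<open>e\<close> passes to its complement \<open>ce\<close>.\<close>

lemma commute_minus: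
  assumes "x \<in> carrier R" "y \<in> carrier R" "z \<in> carrier R" "z \<otimes> x = y \<otimes> z"
  shows "z \<otimes> (\<one> \<ominus> x) = (\<one> \<ominus> y) \<otimes> z"
  using assms by (simp add: a_minus_def r_distr l_distr r_minus l_minus)

lemma ce_commute: "\<lbrakk>g \<in> carrier G; h \<in> carrier G\<rbrakk> \<Longrightarrow> e g \<otimes> ce h = ce h \<otimes> e g"
  by (intro commute_minus e_commute) auto

lemma e_fam: "e \<in> carrier G \<rightarrow> carrier R" by auto

lemma ce_fam: "ce \<in> carrier G \<rightarrow> carrier R" by auto

lemma ce_ce_commute: "\<lbrakk>g \<in> carrier G; h \<in> carrier G\<rbrakk> \<Longrightarrow> ce g \<otimes> ce h = ce h \<otimes> ce g"
  by (intro commute_minus ce_commute[symmetric]) auto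

lemma e_ce: "g \<in> carrier G \<Longrightarrow> e g \<otimes> ce g = \<zero>"
  by (simp add: a_minus_def r_distr r_minus e_idem r_neg)

lemmas e_prod_closed [simp] = finprod_commuting_closed[OF e_fam e_commute]
lemmas ce_prod_closed [simp] = finprod_commuting_closed[OF ce_fam ce_ce_commute]
lemmas e_prod_insert = finprod_commuting_insert[OF e_fam e_commute]
lemmas ce_prod_insert = finprod_commuting_insert[OF ce_fam ce_ce_commute]

section \<open>The projections attached to subsets of the group\<close>

lemma finite_sub [simp]: "A \<subseteq> carrier G \<Longrightarrow> finite A"
  using finite_G by (rule finite_subset[rotated])

lemma P_closed [simp]: "A \<subseteq> carrier G \<Longrightarrow> P A \<in> carrier R"
  unfolding P_def by simp

lemma e_P_commute:
  assumes "g \<in> carrier G" "A \<subseteq> carrier G"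
  shows "e g \<otimes> P A = P A \<otimes> e g"
proof -
  have "e g \<otimes> finprod R e A = finprod R e A \<otimes> e g"
    using assms by (intro finprod_commuting_commute[OF e_fam e_commute] e_commute) auto
  moreover have "e g \<otimes> finprod R ce (carrier G - A) = finprod R ce (carrier G - A) \<otimes> e g"
    using assms by (intro finprod_commuting_commute[OF ce_fam ce_ce_commute] ce_commute) auto
  ultimately show ?thesis
    using assms unfolding P_def by (metis (no_types, lifting) Diff_subset ce_prod_closed e_closed e_prod_closed m_assoc)
qed

lemma e_P_mem:
  assumes "g \<in> A" "A \<subseteq> carrier G"
  shows "e g \<otimes> P A = P A"
proof -
  have g: "g \<in> carrier G" using assms by auto
  have "finprod R e A = e g \<otimes> finprod R e (A - {g})"
    using assms by (intro finprod_commuting_remove[OF e_fam e_commute]) auto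
  moreover have "finprod R e (A - {g}) \<in> carrier R"
    using assms by (intro e_prod_closed) auto
  ultimately have "e g \<otimes> finprod R e A = finprod R e A"
    using g by (simp add: m_assoc[symmetric] e_idem)
  then show ?thesis
    using g assms by (simp add: P_def m_assoc[symmetric])
qed

text \<open>\<open>P A\<close> contains the factor \<open>ce g\<close>, and \<open>e g\<close>
  annihilates it once moved past the first product.\<close>

lemma e_P_not_mem:
  assumes "g \<in> carrier G" "g \<notin> A" "A \<subseteq> carrier G"
  shows "e g \<otimes> P A = \<zero>"
proof -
  have c: "finprod R ce (carrier G - A - {g}) \<in> carrier R"
    by (intro ce_prod_closed) auto
  have "finprod R ce (carrier G - A) = ce g \<otimes> finprod R ce (carrier G - A - {g})"
    using assms by (intro finprod_commuting_remove[OF ce_fam ce_ce_commute]) auto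
  then have z: "e g \<otimes> finprod R ce (carrier G - A) = \<zero>"
    using assms c by (simp add: m_assoc[symmetric] e_ce)
  have "e g \<otimes> finprod R e A = finprod R e A \<otimes> e g"
    using assms by (intro finprod_commuting_commute[OF e_fam e_commute] e_commute) auto
  then have "e g \<otimes> P A = finprod R e A \<otimes> (e g \<otimes> finprod R ce (carrier G - A))"
    using assms by (simp add: P_def m_assoc[symmetric])
  then show ?thesis using assms by (simp add: z)
qed

lemma e_P: "\<lbrakk>g \<in> carrier G; A \<subseteq> carrier G\<rbrakk> \<Longrightarrow> e g \<otimes> P A = (if g \<in> A then P A else \<zero>)"
  by (simp add: e_P_mem e_P_not_mem)

text \<open>The hypothesis says that \<open>z\<close> is a joint eigenvector of the \<open>e g\<close> with spectrum \<open>B\<close>.\<close>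

lemma eigen_P:
  assumes z: "z \<in> carrier R" and AB: "A \<subseteq> carrier G" "B \<subseteq> carrier G"
    and eig: "\<And>g. g \<in> carrier G \<Longrightarrow> z \<otimes> e g = (if g \<in> B then z else \<zero>)"
  shows "z \<otimes> P A = (if A = B then z else \<zero>)"
proof (cases "A = B")
  case True
  have "z \<otimes> ce g = z" if "g \<in> carrier G" "g \<notin> B" for g
    using that eig[of g] z by (simp add: a_minus_def r_distr r_minus)
  then have "z \<otimes> finprod R ce (carrier G - A) = z"
    using True z by (intro finprod_commuting_absorb[OF ce_fam ce_ce_commute]) auto
  moreover have "z \<otimes> finprod R e A = z"
    using True z AB eig by (intro finprod_commuting_absorb[OF e_fam e_commute]) auto
  ultimately show ?thesis
    using True AB z by (simp add: P_def m_assoc[symmetric])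
next
  case False
  \<comment> \<open>At a point \<open>g\<close> of exactly one of the two sets, bracketing
    \<open>z \<otimes> e g \<otimes> P A\<close> in both ways gives \<open>z \<otimes> P A\<close>
    on one side and zero on the other.\<close>
  then obtain g where g: "g \<in> carrier G" "g \<in> A \<longleftrightarrow> g \<notin> B"
    using AB by blast
  have eq: "z \<otimes> (e g \<otimes> P A) = (z \<otimes> e g) \<otimes> P A"
    using g z AB by (simp add: m_assoc)
  show ?thesis
    using eq g z AB eig[OF g(1)] False by (auto simp: e_P split: if_splits)
qed

text \<open>\<open>P B\<close> is itself a joint eigenvector with spectrum \<open>B\<close>, so
  \<open>eigen_P\<close> applies.\<close>

lemma P_P: "\<lbrakk>A \<subseteq> carrier G; B \<subseteq> carrier G\<rbrakk> \<Longrightarrow> P B \<otimes> P A = (if A = B then P B else \<zero>)"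
  by (rule eigen_P) (simp_all add: e_P_commute[symmetric] e_P)

text \<open>One and the same element both fixes and kills \<open>P A\<close>: either
  \<open>e a = e (a \<otimes> h)\<close> with exactly one index in \<open>A\<close>, or
  \<open>e h = \<one>\<close> with \<open>h\<close> outside \<open>A\<close>.\<close>

lemma P_eq_zero:
  assumes A: "A \<subseteq> carrier G" "A \<notin> coset_unions G H"
  shows "P A = \<zero>"
proof (cases "H \<subseteq> A")
  case True
  then obtain a h where "a \<in> A" "h \<in> H" "a \<otimes>\<^bsub>G\<^esub> h \<notin> A"
    using A coset_unions_iff[OF G.group_axioms H.subgroup_axioms] by blast
  then show ?thesis
    using e_P[of a A] e_P[of "a \<otimes>\<^bsub>G\<^esub> h" A] e_mult_subgroup[of a h] A(1) by auto
next
  case False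
  then obtain h where "h \<in> H" "h \<notin> A" by blast
  then show ?thesis
    using e_P[of h A] e_subgroup[of h] A(1) by auto
qed

text \<open>This is the expansion of the product of all \<open>e x \<oplus> ce x = \<one>\<close>
  over \<open>F\<close>. In the induction, subsets without \<open>x\<close> contribute
  \<open>ce x\<close> times the old sum, subsets with \<open>x\<close> contribute \<open>e x\<close>
  times it.\<close>

lemma sum_P_Pow:
  assumes "finite F" "F \<subseteq> carrier G"
  shows "(\<Oplus>A\<in>Pow F. finprod R e A \<otimes> finprod R ce (F - A)) = \<one>"
  using assms
proof (induction F rule: finite_induct)
  case empty
  then show ?case
    by (simp add: finprod_def)
next
  case (insert x F)
  let ?Q = "\<lambda>F A. finprod R e A \<otimes> finprod R ce (F - A)"
  have x: "x \<in> carrier G" and F: "F \<subseteq> carrier G" using insert.prems by auto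
  have c: "?Q K A \<in> carrier R" if "A \<subseteq> carrier G" "K \<subseteq> carrier G" for A K
    using that by (intro m_closed e_prod_closed ce_prod_closed) auto
  have 1: "?Q (insert x F) A = ce x \<otimes> ?Q F A" if A: "A \<in> Pow F" for A
  proof -
    have "insert x F - A = insert x (F - A)" using A insert.hyps by auto
    then have "finprod R ce (insert x F - A) = ce x \<otimes> finprod R ce (F - A)"
      using x F insert.hyps by (simp add: ce_prod_insert subset_iff)
    moreover have "ce x \<otimes> finprod R e A = finprod R e A \<otimes> ce x"
      using A F x by (intro finprod_commuting_commute[OF e_fam e_commute] ce_commute[symmetric]) auto
    moreover have "finprod R e A \<in> carrier R" "finprod R ce (F - A) \<in> carrier R"
      using A F by (auto intro!: e_prod_closed ce_prod_closed)
    ultimately show ?thesis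
      using x by (simp add: m_assoc[symmetric])
  qed
  have 2: "?Q (insert x F) (insert x A) = e x \<otimes> ?Q F A" if A: "A \<in> Pow F" for A
  proof -
    have "insert x F - insert x A = F - A" using insert.hyps by auto
    moreover have "finprod R e (insert x A) = e x \<otimes> finprod R e A"
      using A F x insert.hyps finite_subset by (intro e_prod_insert) auto
    moreover have "finprod R e A \<in> carrier R" "finprod R ce (F - A) \<in> carrier R"
      using A F by (auto intro!: e_prod_closed ce_prod_closed)
    ultimately show ?thesis
      using x by (simp add: m_assoc)
  qed
  have inj: "inj_on (insert x) (Pow F)"
    using insert.hyps by (auto simp: inj_on_def)
  have cF: "?Q F \<in> Pow F \<rightarrow> carrier R" using c F by blast
  have "(\<Oplus>A\<in>Pow (insert x F). ?Q (insert x F) A) =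
      (\<Oplus>A\<in>Pow F. ?Q (insert x F) A) \<oplus> (\<Oplus>A\<in>insert x ` Pow F. ?Q (insert x F) A)"
    unfolding Pow_insert using insert.hyps insert.prems
    by (intro finsum_Un_disjoint) (auto intro!: c)
  also have "(\<Oplus>A\<in>insert x ` Pow F. ?Q (insert x F) A) = (\<Oplus>A\<in>Pow F. ?Q (insert x F) (insert x A))"
    using inj insert.prems by (intro finsum_reindex) (auto intro!: c)
  also have "\<dots> = (\<Oplus>A\<in>Pow F. e x \<otimes> ?Q F A)"
    using 2 cF x by (intro finsum_cong') auto
  also have "\<dots> = e x \<otimes> (\<Oplus>A\<in>Pow F. ?Q F A)"
    using insert.hyps cF x by (intro finsum_rdistr[symmetric]) auto
  also have "(\<Oplus>A\<in>Pow F. ?Q (insert x F) A) = (\<Oplus>A\<in>Pow F. ce x \<otimes> ?Q F A)"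
    using 1 cF x by (intro finsum_cong') auto
  also have "\<dots> = ce x \<otimes> (\<Oplus>A\<in>Pow F. ?Q F A)"
    using insert.hyps cF x by (intro finsum_rdistr[symmetric]) auto
  finally show ?case
    using insert.IH[OF F] x by (simp add: a_minus_def add.m_assoc l_neg)
qed

lemmas coset_unions_subset_G = coset_unions_subset[where G = G and H = H]

lemma sum_P: "(\<Oplus>A\<in>coset_unions G H. P A) = \<one>"
proof -
  have "(\<Oplus>A\<in>coset_unions G H. P A) = (\<Oplus>A\<in>Pow (carrier G). P A)"
    using finite_G coset_unions_subset_G P_eq_zero
    by (intro add.finprod_mono_neutral_cong_left) auto
  then show ?thesis
    using sum_P_Pow[OF finite_G] by (simp add: P_def)
qed

text \<open>By \<open>u_e\<close>, passing \<open>u g\<close> through either product translates its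
  index set, and the translate of a complement is the complement of the translate.\<close>

lemma u_P:
  assumes g: "g \<in> carrier G" and A: "A \<subseteq> carrier G"
  shows "u g \<otimes> P A = P (g <#\<^bsub>G\<^esub> A) \<otimes> u g"
proof -
  have inj: "inj_on (\<lambda>a. g \<otimes>\<^bsub>G\<^esub> a) B" if "B \<subseteq> carrier G" for B
    using that g by (auto simp: inj_on_def subset_iff)
  have gA: "g <#\<^bsub>G\<^esub> A \<subseteq> carrier G"
    using A g by (rule G.l_coset_subset_G)
  have 1: "u g \<otimes> finprod R e A = finprod R e (g <#\<^bsub>G\<^esub> A) \<otimes> u g"
    unfolding translate_image[OF G.group_axioms H.subgroup_axioms] using A g inj[OF A]
    by (intro finprod_commuting_intertwine[OF e_fam e_commute] u_e) auto
  have 2: "u g \<otimes> finprod R ce (carrier G - A) = finprod R ce (carrier G - (g <#\<^bsub>G\<^esub> A)) \<otimes> u g"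
    unfolding translate_Diff[OF G.group_axioms H.subgroup_axioms A g, symmetric]
    unfolding translate_image[OF G.group_axioms H.subgroup_axioms] using A g inj
    by (intro finprod_commuting_intertwine[OF ce_fam ce_ce_commute] commute_minus u_e) auto
  have c: "finprod R e A \<in> carrier R" "finprod R e (g <#\<^bsub>G\<^esub> A) \<in> carrier R"
    "finprod R ce (carrier G - A) \<in> carrier R" "finprod R ce (carrier G - (g <#\<^bsub>G\<^esub> A)) \<in> carrier R"
    using A gA by (auto intro!: e_prod_closed ce_prod_closed)
  have "u g \<otimes> P A = (u g \<otimes> finprod R e A) \<otimes> finprod R ce (carrier G - A)"
    using g c by (simp add: P_def m_assoc)
  also have "\<dots> = finprod R e (g <#\<^bsub>G\<^esub> A) \<otimes> (u g \<otimes> finprod R ce (carrier G - A))"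
    unfolding 1 using g c by (simp add: m_assoc)
  also have "\<dots> = P (g <#\<^bsub>G\<^esub> A) \<otimes> u g"
    unfolding 2 using g c by (simp add: P_def m_assoc)
  finally show ?thesis .
qed

text \<open>\<open>u g\<close> absorbs \<open>e (inv g)\<close> on its right, and that idempotent
  kills \<open>P A\<close>.\<close>

lemma u_P_eq_zero:
  assumes "g \<in> carrier G" "A \<subseteq> carrier G" "inv\<^bsub>G\<^esub> g \<notin> A"
  shows "u g \<otimes> P A = \<zero>"
proof -
  have "u g \<otimes> P A = u g \<otimes> (e (inv\<^bsub>G\<^esub> g) \<otimes> P A)"
    using assms by (simp add: m_assoc[symmetric] u_e_inv)
  then show ?thesis
    using assms by (simp add: e_P)
qed

text \<open>This is the law of \<open>groupoid_mult\<close>. Rewriting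
  \<open>u h \<otimes> P B\<close> as \<open>P (h <# B) \<otimes> u h\<close> brings two projections
  together, and orthogonality compares \<open>A\<close> with \<open>h <# B\<close>. The idempotent
  \<open>e (inv h)\<close> arising from \<open>u g \<otimes> u h\<close> is absorbed by
  \<open>P B\<close>.\<close>

lemma uP_mult:
  assumes g: "g \<in> carrier G" "A \<subseteq> carrier G"
    and h: "h \<in> carrier G" "B \<subseteq> carrier G" "inv\<^bsub>G\<^esub> h \<in> B"
  shows "(u g \<otimes> P A) \<otimes> (u h \<otimes> P B) = (if A = h <#\<^bsub>G\<^esub> B then u (g \<otimes>\<^bsub>G\<^esub> h) \<otimes> P B else \<zero>)"
proof -
  have hB: "h <#\<^bsub>G\<^esub> B \<subseteq> carrier G"
    using h(2,1) by (rule G.l_coset_subset_G)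
  have "(u g \<otimes> P A) \<otimes> (u h \<otimes> P B) = u g \<otimes> (P A \<otimes> P (h <#\<^bsub>G\<^esub> B)) \<otimes> u h"
    using g h hB by (simp add: u_P[of h B] m_assoc)
  moreover have "u g \<otimes> P (h <#\<^bsub>G\<^esub> B) \<otimes> u h = u (g \<otimes>\<^bsub>G\<^esub> h) \<otimes> P B"
  proof -
    have "u g \<otimes> P (h <#\<^bsub>G\<^esub> B) \<otimes> u h = (u g \<otimes> u h) \<otimes> P B"
      using g h hB by (simp add: u_P[of h B] m_assoc)
    also have "\<dots> = u (g \<otimes>\<^bsub>G\<^esub> h) \<otimes> (e (inv\<^bsub>G\<^esub> h) \<otimes> P B)"
      using g h by (simp add: u_mult_right m_assoc)
    finally show ?thesis using g h by (simp add: e_P)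
  qed
  ultimately show ?thesis
    using g h hB by (auto simp: P_P)
qed

end

section \<open>Homomorphisms out of the groupoid algebra and transport of projections\<close>

context partial_rep
begin

text \<open>Every partial representation extends to the groupoid algebra: \<open>uP_mult\<close>
  gives multiplicativity and \<open>sum_P\<close> the unit. For the universal representation this is
  the inverse map of the theorem.\<close>

lemma uP_lin_ext:
  assumes "partial_basis (par_groupoid G H) (groupoid_mult G) (\<Sum>A\<in>coset_unions G H. basis_elem (A, \<one>\<^bsub>G\<^esub>))"
  defines "\<nu> \<equiv> lin_ext R (\<lambda>(A, g). u g \<otimes> P A)"
  shows "\<nu> \<in> algebra_hom (groupoid_algebra G H) R"
    and "g \<in> carrier G \<Longrightarrow> \<nu> (mu_p G H g) = u g"
    and "(A, g) \<in> par_groupoid G H \<Longrightarrow> \<nu> (basis_elem (A, g)) = u g \<otimes> P A"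
proof -
  let ?f = "\<lambda>(A, g). u g \<otimes> P A"
  have f: "?f \<in> par_groupoid G H \<rightarrow> carrier R"
    by (auto simp: par_groupoid_def coset_unions_subset_G)
  have one: "\<nu> (\<Sum>A\<in>coset_unions G H. basis_elem (A, \<one>\<^bsub>G\<^esub>)) = \<one>"
  proof -
    have "\<nu> (\<Sum>A\<in>coset_unions G H. basis_elem (A, \<one>\<^bsub>G\<^esub>)) = (\<Oplus>A\<in>coset_unions G H. u \<one>\<^bsub>G\<^esub> \<otimes> P A)"
      unfolding \<nu>_def using H.one_closed
      by (subst lin_ext_sum[OF f]) (auto simp: finite_coset_unions finite_G par_groupoid_def coset_unions_def)
    also have "\<dots> = (\<Oplus>A\<in>coset_unions G H. P A)"
      by (intro finsum_cong') (auto simp: u_one coset_unions_subset_G)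
    finally show ?thesis by (simp add: sum_P)
  qed
  show "\<nu> \<in> algebra_hom (groupoid_algebra G H) R"
    unfolding groupoid_algebra_def \<nu>_def
  proof (rule lin_ext_algebra_hom[OF f])
    fix x y assume xy: "x \<in> par_groupoid G H" "y \<in> par_groupoid G H"
    then show "?f x \<otimes> ?f y = (case groupoid_mult G x y of None \<Rightarrow> \<zero> | Some z \<Rightarrow> ?f z)"
      by (cases x; cases y) (simp add: par_groupoid_def groupoid_mult_def uP_mult coset_unions_subset_G)
  qed (use one assms(1) in \<open>simp_all add: \<nu>_def\<close>)
  show "\<nu> (mu_p G H g) = u g" if g: "g \<in> carrier G"
  proof -
    have "\<nu> (mu_p G H g) = (\<Oplus>A\<in>{A \<in> coset_unions G H. inv\<^bsub>G\<^esub> g \<in> A}. u g \<otimes> P A)"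
      unfolding \<nu>_def mu_p_def using g
      by (subst lin_ext_sum[OF f]) (auto simp: finite_coset_unions finite_G par_groupoid_def)
    \<comment> \<open>The objects added here do not contain \<open>inv g\<close>, so their terms
      vanish by \<open>u_P_eq_zero\<close>; the complete sum of projections is then
      \<open>\<one>\<close>.\<close>
    also have "\<dots> = (\<Oplus>A\<in>coset_unions G H. u g \<otimes> P A)"
      using g by (intro add.finprod_mono_neutral_cong_left)
        (auto simp: finite_coset_unions finite_G coset_unions_subset_G u_P_eq_zero)
    also have "\<dots> = u g \<otimes> (\<Oplus>A\<in>coset_unions G H. P A)"
      using g by (intro finsum_rdistr[symmetric]) (auto simp: finite_coset_unions finite_G coset_unions_subset_G)
    finally show ?thesis using g by (simp add: sum_P)
  qed
  show "\<nu> (basis_elem (A, g)) = u g \<otimes> P A" if "(A, g) \<in> par_groupoid G H"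
    using funcset_mem[OF f that] unfolding \<nu>_def by (subst lin_ext_single) auto
qed

lemma hom_P:
  assumes "h \<in> algebra_hom R S" "partial_rep S G H v"
    and v: "\<And>g. g \<in> carrier G \<Longrightarrow> h (u g) = v g" and "A \<subseteq> carrier G"
  shows "h (P A) = partial_rep.P S G v A"
proof -
  interpret S: partial_rep S G H v by fact
  interpret h: ring_hom_ring R S h
    by (rule algebra_hom_ring_hom_ring) (use assms(1) complex_algebra_axioms S.complex_algebra_axioms in auto)
  have hr: "h \<in> ring_hom R S" using assms(1) by (simp add: algebra_hom_def)
  have e: "h (e g) = S.e g" if "g \<in> carrier G" for g
    using that by (simp add: e_def S.e_def v)
  have "h (finprod R e A) = finprod S S.e A"
    using assms(4) by (intro ring_hom_finprod_commuting[OF ring_axioms S.ring_axioms hr] e_commute) (auto simp: e)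
  moreover have "h (finprod R ce (carrier G - A)) = finprod S S.ce (carrier G - A)"
    by (intro ring_hom_finprod_commuting[OF ring_axioms S.ring_axioms hr] ce_ce_commute)
      (auto simp: e a_minus_def)
  ultimately show ?thesis
    using assms(4) by (simp add: P_def S.P_def)
qed

end

subsection \<open>The groupoid algebra\<close>

locale finite_group_subgroup = group G + H: subgroup H G for G :: "('a, 'm) monoid_scheme" (structure) and H +
  assumes finite_G: "finite (carrier G)"
begin

abbreviation "CU \<equiv> coset_unions G H"
abbreviation "\<Gamma> \<equiv> par_groupoid G H"
abbreviation "unit_sum \<equiv> \<Sum>A\<in>CU. basis_elem (A, \<one>)"
abbreviation "GA \<equiv> groupoid_algebra G H"

lemma CU_iff: "A \<in> CU \<longleftrightarrow> A \<subseteq> carrier G \<and> H \<subseteq> A \<and> (\<forall>a\<in>A. \<forall>h\<in>H. a \<otimes> h \<in> A)"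
  using coset_unions_iff group_axioms H.subgroup_axioms .

lemmas CU_subset = coset_unions_subset[where G = G and H = H]

lemma one_mem_CU: "A \<in> CU \<Longrightarrow> \<one> \<in> A"
  using H.one_closed by (auto simp: CU_iff)

lemma CU_translate: "\<lbrakk>A \<in> CU; g \<in> carrier G; inv g \<in> A\<rbrakk> \<Longrightarrow> g <# A \<in> CU"
  using translate_coset_unions group_axioms H.subgroup_axioms .

lemma mem_translate: "\<lbrakk>A \<subseteq> carrier G; g \<in> carrier G; x \<in> carrier G\<rbrakk> \<Longrightarrow> x \<in> g <# A \<longleftrightarrow> inv g \<otimes> x \<in> A"
  using mem_translate_iff group_axioms H.subgroup_axioms .

lemma groupoid_basis_mult:
  "basis_elem (A, g) \<otimes>\<^bsub>basis_algebra S (groupoid_mult G) v\<^esub> basis_elem (B, h) =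
    (if A = h <# B then basis_elem (B, g \<otimes> h) else 0)"
  by (simp add: basis_mult_single groupoid_mult_def)

lemma partial_basis_groupoid: "partial_basis \<Gamma> (groupoid_mult G) unit_sum"
proof
  fix x y z assume "x \<in> \<Gamma>" "y \<in> \<Gamma>" "groupoid_mult G x y = Some z"
  then show "z \<in> \<Gamma>"
    by (auto simp: par_groupoid_def groupoid_mult_def mem_translate CU_subset inv_mult_group split: if_splits)
next
  fix x y z assume "x \<in> \<Gamma>" "y \<in> \<Gamma>" "z \<in> \<Gamma>"
  then show "Option.bind (groupoid_mult G x y) (\<lambda>w. groupoid_mult G w z) =
      Option.bind (groupoid_mult G y z) (groupoid_mult G x)"
    by (auto simp: par_groupoid_def groupoid_mult_def CU_subset lcos_m_assoc m_assoc)
next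
  show "Poly_Mapping.keys unit_sum \<subseteq> \<Gamma>"
    by (intro keys_sum_subset) (auto simp: par_groupoid_def one_mem_CU)
next
  fix x assume "x \<in> \<Gamma>"
  then obtain A g where x: "x = (A, g)" "A \<in> CU" "g \<in> carrier G" "inv g \<in> A"
    by (auto simp: par_groupoid_def)
  \<comment> \<open>On the left only the range \<open>g <# A\<close> of the arrow contributes; it
    occurs in the sum because it is again an object. On the right only the source \<open>A\<close>
    contributes.\<close>
  then show "unit_sum \<otimes>\<^bsub>basis_algebra \<Gamma> (groupoid_mult G) unit_sum\<^esub> basis_elem x = basis_elem x"
    using CU_translate[of A g]
    by (simp add: basis_mult_sum_left groupoid_basis_mult finite_coset_unions finite_G)
  have "(\<Sum>B\<in>CU. if A = \<one> <# B then basis_elem (B, g \<otimes> \<one>) else 0) =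
      (\<Sum>B\<in>CU. if A = B then basis_elem (B, g) else 0)"
    using x by (intro sum.cong) (auto simp: lcos_mult_one CU_subset)
  then show "basis_elem x \<otimes>\<^bsub>basis_algebra \<Gamma> (groupoid_mult G) unit_sum\<^esub> unit_sum = basis_elem x"
    using x by (simp add: basis_mult_sum_right groupoid_basis_mult finite_coset_unions finite_G)
qed

sublocale GA: partial_basis \<Gamma> "groupoid_mult G" unit_sum
  rewrites "basis_algebra \<Gamma> (groupoid_mult G) unit_sum = GA"
  by (rule partial_basis_groupoid) (simp add: groupoid_algebra_def)

lemmas GA_mult = groupoid_basis_mult[where S = \<Gamma> and v = unit_sum, folded groupoid_algebra_def]
lemmas GA_sum_left = basis_mult_sum_left[where S = \<Gamma> and m = "groupoid_mult G" and u = unit_sum, folded groupoid_algebra_def]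
lemmas GA_sum_right = basis_mult_sum_right[where S = \<Gamma> and m = "groupoid_mult G" and u = unit_sum, folded groupoid_algebra_def]

text \<open>Products of the \<open>mu_p\<close> stay in this family, with \<open>W\<close> recording the partial products.\<close>

definition mu_sum :: "'a \<Rightarrow> 'a set \<Rightarrow> ('a set \<times> 'a) \<Rightarrow>\<^sub>0 complex" where
  "mu_sum g W = (\<Sum>B\<in>{B \<in> CU. W \<subseteq> B}. basis_elem (B, g))"

lemma mu_p_eq: "mu_p G H g = mu_sum g {inv g}"
  by (simp add: mu_p_def mu_sum_def)

text \<open>At most one arrow of \<open>mu_p G H g\<close> is composable with \<open>(B, h)\<close>,
  the one with source \<open>h <# B\<close>. It is present iff \<open>inv g\<close> lies in that
  translate.\<close>

lemma mu_p_mult_basis: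
  assumes "B \<in> CU" "h \<in> carrier G" "inv h \<in> B" "g \<in> carrier G"
  shows "mu_p G H g \<otimes>\<^bsub>GA\<^esub> basis_elem (B, h) =
    (if inv (g \<otimes> h) \<in> B then basis_elem (B, g \<otimes> h) else 0)"
proof -
  have "mu_p G H g \<otimes>\<^bsub>GA\<^esub> basis_elem (B, h) =
      (\<Sum>A\<in>{A \<in> CU. inv g \<in> A}. if A = h <# B then basis_elem (B, g \<otimes> h) else 0)"
    by (simp add: mu_p_def GA_sum_left GA_mult)
  moreover have "inv g \<in> h <# B \<longleftrightarrow> inv (g \<otimes> h) \<in> B"
    using assms by (simp add: mem_translate CU_subset inv_mult_group)
  ultimately show ?thesis
    using CU_translate[of B h] assms by (simp add: finite_coset_unions finite_G)
qed

text \<open>\<open>inv h \<in> W\<close> guarantees that all pairs in the sum are arrows;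
  multiplication then keeps those \<open>B\<close> that also contain
  \<open>inv (g \<otimes> h)\<close>.\<close>

lemma mu_p_mult_mu_sum:
  assumes "g \<in> carrier G" "h \<in> carrier G" "inv h \<in> W"
  shows "mu_p G H g \<otimes>\<^bsub>GA\<^esub> mu_sum h W = mu_sum (g \<otimes> h) (insert (inv (g \<otimes> h)) W)"
proof -
  have "mu_p G H g \<otimes>\<^bsub>GA\<^esub> mu_sum h W =
      (\<Sum>B\<in>{B \<in> CU. W \<subseteq> B}. if inv (g \<otimes> h) \<in> B then basis_elem (B, g \<otimes> h) else 0)"
    unfolding mu_sum_def GA_sum_right using assms
    by (intro sum.cong refl mu_p_mult_basis) auto
  also have "\<dots> = mu_sum (g \<otimes> h) (insert (inv (g \<otimes> h)) W)"
    unfolding mu_sum_def by (subst sum.inter_filter[symmetric])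
      (auto simp: finite_coset_unions finite_G intro!: sum.cong)
  finally show ?thesis .
qed

lemma mu_sum_insert_H: "h \<in> H \<Longrightarrow> mu_sum g (insert h W) = mu_sum g W"
  unfolding mu_sum_def by (rule sum.cong) (auto simp: CU_iff)

lemma mu_p_one: "mu_p G H \<one> = \<one>\<^bsub>GA\<^esub>"
  using mu_sum_insert_H[OF H.one_closed, of \<one> "{}"]
  by (simp add: mu_p_eq) (simp add: mu_sum_def groupoid_algebra_def)

lemma mu_p_closed: "g \<in> carrier G \<Longrightarrow> mu_p G H g \<in> carrier GA"
  unfolding mu_p_def groupoid_algebra_def basis_algebra_simps mem_Collect_eq
  by (intro keys_sum_subset) (auto simp: par_groupoid_def)

lemma partial_rep_mu_p: "partial_rep GA G H (mu_p G H)"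
proof
  show "finite (carrier G)" by (rule finite_G)
next
  fix g assume "g \<in> carrier G"
  then show "mu_p G H g \<in> carrier GA" by (rule mu_p_closed)
next
  show "mu_p G H \<one> = \<one>\<^bsub>GA\<^esub>" by (rule mu_p_one)
next
  fix g g' assume g: "g \<in> carrier G" "g' \<in> carrier G"
  \<comment> \<open>Right bracketing lets \<open>mu_p_mult_mu_sum\<close> be applied repeatedly.
    Both sides become \<open>mu_sum g'\<close> with the conditions \<open>inv g'\<close> and
    \<open>inv (g \<otimes> g')\<close>.\<close>
  have "mu_p G H (inv g) \<otimes>\<^bsub>GA\<^esub> (mu_p G H g \<otimes>\<^bsub>GA\<^esub> mu_p G H g') =
      mu_p G H (inv g) \<otimes>\<^bsub>GA\<^esub> mu_p G H (g \<otimes> g')"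
    unfolding mu_p_eq[of g'] mu_p_eq[of "g \<otimes> g'"] using g
    by (simp add: mu_p_mult_mu_sum insert_commute m_assoc[symmetric])
  then show "mu_p G H (inv g) \<otimes>\<^bsub>GA\<^esub> mu_p G H g \<otimes>\<^bsub>GA\<^esub> mu_p G H g' =
      mu_p G H (inv g) \<otimes>\<^bsub>GA\<^esub> mu_p G H (g \<otimes> g')"
    using g by (simp add: GA.m_assoc mu_p_closed)
  \<comment> \<open>Here the left side has the extra condition that \<open>\<one>\<close> be a
    member, which holds for every object because it contains \<open>H\<close>.\<close>
  have "mu_p G H g' \<otimes>\<^bsub>GA\<^esub> (mu_p G H g \<otimes>\<^bsub>GA\<^esub> mu_p G H (inv g)) =
      mu_p G H (g' \<otimes> g) \<otimes>\<^bsub>GA\<^esub> mu_p G H (inv g)"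
    unfolding mu_p_eq[of "inv g"] using g
    by (simp add: mu_p_mult_mu_sum m_assoc) (simp add: insert_commute[of _ \<one>] mu_sum_insert_H)
  then show "mu_p G H g' \<otimes>\<^bsub>GA\<^esub> mu_p G H g \<otimes>\<^bsub>GA\<^esub> mu_p G H (inv g) =
      mu_p G H (g' \<otimes> g) \<otimes>\<^bsub>GA\<^esub> mu_p G H (inv g)"
    using g by (simp add: GA.m_assoc mu_p_closed)
next
  fix h assume "h \<in> H"
  then show "mu_p G H h \<otimes>\<^bsub>GA\<^esub> mu_p G H (inv h) = \<one>\<^bsub>GA\<^esub>"
    unfolding mu_p_eq[of "inv h"] mu_p_one[symmetric] mu_p_eq[of \<one>]
    using mu_p_mult_mu_sum[of h "inv h" "{inv (inv h)}"] by (simp add: mu_sum_insert_H)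
qed

sublocale mu: partial_rep GA G H "mu_p G H"
  by (rule partial_rep_mu_p)

lemma mu_P:
  assumes A: "A \<in> CU"
  shows "mu.P A = basis_elem (A, \<one>)"
proof -
  have e: "mu.e g = mu_sum \<one> {g}" if "g \<in> carrier G" for g
    unfolding mu.e_def mu_p_eq[of "inv g"]
    using that by (simp add: mu_p_mult_mu_sum mu_sum_insert_H)
  have c: "basis_elem (B, \<one>) \<in> carrier GA" if "B \<in> CU" for B
    using that by (simp add: groupoid_algebra_def par_groupoid_def one_mem_CU)
  have "basis_elem (B, \<one>) \<otimes>\<^bsub>GA\<^esub> mu.P A = (if A = B then basis_elem (B, \<one>) else 0)" if B: "B \<in> CU" for B
  proof -
    have "basis_elem (B, \<one>) \<otimes>\<^bsub>GA\<^esub> mu.e g = (if g \<in> B then basis_elem (B, \<one>) else \<zero>\<^bsub>GA\<^esub>)"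
      if "g \<in> carrier G" for g
    proof -
      have "basis_elem (B, \<one>) \<otimes>\<^bsub>GA\<^esub> mu.e g =
          (\<Sum>A\<in>{A \<in> CU. g \<in> A}. if B = A then basis_elem (A, \<one>) else 0)"
        unfolding e[OF that] mu_sum_def GA_sum_right
        by (intro sum.cong) (auto simp: GA_mult lcos_mult_one CU_subset)
      then show ?thesis using B by (simp add: finite_coset_unions finite_G groupoid_algebra_def)
    qed
    from mu.eigen_P[OF c[OF B] _ _ this] show ?thesis
      using A B by (simp add: CU_subset groupoid_algebra_def)
  qed
  \<comment> \<open>Summing over all objects turns the left factor into the unit, while only the
    term with \<open>B = A\<close> survives on the right.\<close>
  then have "unit_sum \<otimes>\<^bsub>GA\<^esub> mu.P A = (\<Sum>B\<in>CU. if A = B then basis_elem (B, \<one>) else 0)"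
    unfolding GA_sum_left by (intro sum.cong) auto
  also have "\<dots> = basis_elem (A, \<one>)"
    using A by (simp add: finite_coset_unions finite_G)
  also have "unit_sum = \<one>\<^bsub>GA\<^esub>"
    by (simp add: groupoid_algebra_def)
  finally show ?thesis
    using A by (simp add: CU_subset)
qed

lemma mu_uP:
  assumes "(A, g) \<in> \<Gamma>"
  shows "mu_p G H g \<otimes>\<^bsub>GA\<^esub> mu.P A = basis_elem (A, g)"
  using assms mu_p_mult_basis[of A \<one> g]
  by (auto simp: par_groupoid_def mu_P one_mem_CU)

end

subsection \<open>The free algebra and its quotient\<close>

lemma partial_basis_lists: "partial_basis (lists X) (\<lambda>v w. Some (v @ w)) (basis_elem [])"
  by unfold_locales (auto simp: basis_mult_single)

interpretation free: partial_basis "lists X" "\<lambda>v w. Some (v @ w)" "basis_elem []"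
  rewrites "basis_algebra (lists X) (\<lambda>v w. Some (v @ w)) (basis_elem []) = free_algebra X"
  for X
  by (rule partial_basis_lists) (simp add: free_algebra_def)

lemma free_algebra_simps [simp]:
  "carrier (free_algebra X) = {f. Poly_Mapping.keys f \<subseteq> lists X}"
  "\<one>\<^bsub>free_algebra X\<^esub> = basis_elem []"
  "\<zero>\<^bsub>free_algebra X\<^esub> = 0"
  "f \<oplus>\<^bsub>free_algebra X\<^esub> g = f + g"
  "basis_elem v \<otimes>\<^bsub>free_algebra X\<^esub> basis_elem w = basis_elem (v @ w)"
  by (simp_all add: free_algebra_def basis_mult_single)

lemma free_algebra_minus:
  assumes "p \<in> carrier (free_algebra X)" "q \<in> carrier (free_algebra X)"
  shows "p \<ominus>\<^bsub>free_algebra X\<^esub> q = p - q" "p - q \<in> carrier (free_algebra X)"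
proof -
  have m: "- q \<in> carrier (free_algebra X)"
    using assms by simp
  have "\<ominus>\<^bsub>free_algebra X\<^esub> q = - q"
    using assms m by (intro free.minus_equality) auto
  then show "p \<ominus>\<^bsub>free_algebra X\<^esub> q = p - q"
    by (simp add: a_minus_def)
  then show "p - q \<in> carrier (free_algebra X)"
    using free.minus_closed[OF assms] by simp
qed

text \<open>A word is the product of its letters, so a homomorphism is determined by its values on
  letters.\<close>

lemma hom_basis_word:
  assumes "complex_algebra R" "h \<in> algebra_hom (free_algebra X) R" "w \<in> lists X"
  shows "h (basis_elem w) = foldr (\<lambda>x r. h (basis_elem [x]) \<otimes>\<^bsub>R\<^esub> r) w \<one>\<^bsub>R\<^esub>"
  using assms(3)
proof (induction w)
  case Nil
  then show ?case using algebra_homD(4)[OF assms(2)] by simp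
next
  case (Cons x w)
  then show ?case
    using algebra_homD(2)[OF assms(2), of "basis_elem [x]" "basis_elem w"] by auto
qed

lemma free_algebra_hom_eqI:
  assumes "complex_algebra R" "h \<in> algebra_hom (free_algebra X) R" "k \<in> algebra_hom (free_algebra X) R"
    and "\<And>x. x \<in> X \<Longrightarrow> h (basis_elem [x]) = k (basis_elem [x])" "p \<in> carrier (free_algebra X)"
  shows "h p = k p"
proof (rule free.algebra_hom_eqI[OF assms(1-3)])
  fix w assume w: "w \<in> lists X"
  then show "h (basis_elem w) = k (basis_elem w)"
    unfolding hom_basis_word[OF assms(1,2) w] hom_basis_word[OF assms(1,3) w]
    by (intro foldr_cong) (auto simp: assms(4))
qed (use assms(5) in simp)

text \<open>Universal property of the free algebra: multiplying the images of the letters is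
  multiplicative under concatenation, and linear extension does the rest.\<close>

lemma free_algebra_hom_exists:
  assumes "complex_algebra R" "f \<in> X \<rightarrow> carrier R"
  shows "\<exists>h \<in> algebra_hom (free_algebra X) R. \<forall>x\<in>X. h (basis_elem [x]) = f x"
proof -
  interpret R: complex_algebra R by fact
  define F where "F w = foldr (\<lambda>x r. f x \<otimes>\<^bsub>R\<^esub> r) w \<one>\<^bsub>R\<^esub>" for w
  have F: "F w \<in> carrier R" if "w \<in> lists X" for w
    using that assms(2) by (induction w) (auto simp: F_def)
  have "F (v @ w) = F v \<otimes>\<^bsub>R\<^esub> F w" if "v \<in> lists X" "w \<in> lists X" for v w
    using that(1)
  proof (induction v)
    case Nil
    then show ?case using F[OF that(2)] by (simp add: F_def)
  next
    case (Cons x v)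
    then show ?case
      using F[of v] F[OF that(2)] assms(2) by (auto simp: F_def R.m_assoc Pi_iff)
  qed
  then have "lin_ext R F \<in> algebra_hom (free_algebra X) R"
    unfolding free_algebra_def
  proof (intro R.lin_ext_algebra_hom partial_basis_lists)
    show "F \<in> lists X \<rightarrow> carrier R" using F by blast
    show "lin_ext R F (basis_elem []) = \<one>\<^bsub>R\<^esub>"
      by (subst R.lin_ext_single) (simp_all add: F_def)
  qed simp
  moreover have "lin_ext R F (basis_elem [x]) = f x" if "x \<in> X" for x
    using F[of "[x]"] that assms(2) by (subst R.lin_ext_single) (auto simp: F_def Pi_iff)
  ultimately show ?thesis by blast
qed

section \<open>The presented algebra and its universal property\<close>

context finite_group_subgroup
begin

abbreviation "FA \<equiv> free_algebra (carrier G)"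
abbreviation "I \<equiv> par_ideal G H"
abbreviation "PA \<equiv> par_algebra G H"

lemma par_relations_closed: "par_relations G H \<subseteq> carrier FA"
  unfolding par_relations_def using free_algebra_minus(2)[where X = "carrier G"]
  by (auto simp del: free_algebra_simps(1))
    (simp_all add: free_algebra_minus(2)[where X = "carrier G", unfolded free_algebra_simps(1) mem_Collect_eq])

lemma par_ideal: "ideal I FA" and par_relations_subset_ideal: "par_relations G H \<subseteq> I"
  unfolding par_ideal_def
  using free.genideal_ideal[OF par_relations_closed] free.genideal_self[OF par_relations_closed] by auto

lemma PA_algebra: "complex_algebra PA"
  unfolding par_algebra_def by (rule free.quotient_complex_algebra[OF par_ideal])

definition proj :: "('a list \<Rightarrow>\<^sub>0 complex) \<Rightarrow> ('a list \<Rightarrow>\<^sub>0 complex) set" where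
  "proj x = I +>\<^bsub>FA\<^esub> x"

lemma proj_hom: "proj \<in> algebra_hom FA PA"
  unfolding proj_def par_algebra_def by (rule free.coset_algebra_hom[OF par_ideal])

lemma PA_carrier: "carrier PA = proj ` carrier FA"
  unfolding proj_def par_algebra_def by (rule free.carrier_quotient[OF par_ideal])

lemma par_gen_proj: "par_gen G H g = proj (basis_elem [g])"
  by (simp add: par_gen_def proj_def)

lemma proj_relation:
  assumes "basis_elem v - basis_elem w \<in> par_relations G H" "v \<in> lists (carrier G)" "w \<in> lists (carrier G)"
  shows "proj (basis_elem v) = proj (basis_elem w)"
  unfolding proj_def using assms par_relations_subset_ideal
  by (intro free.coset_eqI[OF par_ideal]) (auto simp: free_algebra_minus(1))

lemma proj_mult:
  assumes "v \<in> lists (carrier G)" "w \<in> lists (carrier G)"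
  shows "proj (basis_elem v) \<otimes>\<^bsub>PA\<^esub> proj (basis_elem w) = proj (basis_elem (v @ w))"
  using algebra_homD(2)[OF proj_hom, of "basis_elem v" "basis_elem w"] assms by simp

text \<open>The laws of a partial representation are the defining relations read in the quotient;
  the first relation identifies the class of the letter \<open>\<one>\<close> with the unit.\<close>

lemma partial_rep_par_gen: "partial_rep PA G H (par_gen G H)"
proof -
  interpret PA: complex_algebra PA by (rule PA_algebra)
  have one: "proj (basis_elem [\<one>]) = \<one>\<^bsub>PA\<^esub>"
    using algebra_homD(4)[OF proj_hom] proj_relation[of "[\<one>]" "[]"] by (simp add: par_relations_def)
  show ?thesis
  proof
    fix g g' assume g: "g \<in> carrier G" "g' \<in> carrier G"
    have "basis_elem [inv g, g, g'] - basis_elem [inv g, g \<otimes> g'] \<in> par_relations G H"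
      "basis_elem [g', g, inv g] - basis_elem [g' \<otimes> g, inv g] \<in> par_relations G H"
      unfolding par_relations_def using g by blast+
    from this[THEN proj_relation]
    show "par_gen G H (inv g) \<otimes>\<^bsub>PA\<^esub> par_gen G H g \<otimes>\<^bsub>PA\<^esub> par_gen G H g' =
        par_gen G H (inv g) \<otimes>\<^bsub>PA\<^esub> par_gen G H (g \<otimes> g')"
      "par_gen G H g' \<otimes>\<^bsub>PA\<^esub> par_gen G H g \<otimes>\<^bsub>PA\<^esub> par_gen G H (inv g) =
        par_gen G H (g' \<otimes> g) \<otimes>\<^bsub>PA\<^esub> par_gen G H (inv g)"
      using g by (simp_all add: par_gen_proj proj_mult)
  next
    fix h assume h: "h \<in> H"
    then have "basis_elem [h, inv h] - basis_elem [\<one>] \<in> par_relations G H"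
      unfolding par_relations_def by blast
    from proj_relation[OF this] show "par_gen G H h \<otimes>\<^bsub>PA\<^esub> par_gen G H (inv h) = \<one>\<^bsub>PA\<^esub>"
      using h by (simp add: par_gen_proj proj_mult one)
  qed (use algebra_homD(1)[OF proj_hom] in \<open>auto simp: par_gen_proj one finite_G\<close>)
qed

sublocale par: partial_rep PA G H "par_gen G H"
  by (rule partial_rep_par_gen)

lemma par_proj_eq: "par_proj G H A = par.P A"
proof -
  have "par_idem G H = par.e"
    by (simp add: fun_eq_iff par_idem_def par.e_def)
  then show ?thesis
    by (simp add: par_proj_def par.P_def)
qed

text \<open>Composition with the surjection \<open>proj\<close> moves the question to the free
  algebra, where values on letters decide.\<close>

lemma PA_hom_eqI:
  assumes "complex_algebra R" "h \<in> algebra_hom PA R" "k \<in> algebra_hom PA R"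
    and eq: "\<And>g. g \<in> carrier G \<Longrightarrow> h (par_gen G H g) = k (par_gen G H g)" and "x \<in> carrier PA"
  shows "h x = k x"
proof -
  obtain p where p: "p \<in> carrier FA" "x = proj p"
    using assms(5) PA_carrier by auto
  show ?thesis
    unfolding p(2)
    by (rule free_algebra_hom_eqI[OF assms(1) algebra_hom_comp[OF proj_hom assms(2)]
          algebra_hom_comp[OF proj_hom assms(3)] _ p(1)])
      (simp add: eq flip: par_gen_proj)
qed

text \<open>Universal property: the extension of \<open>v\<close> to the free algebra kills the
  relations, hence the ideal they generate, and descends to the quotient.\<close>

lemma PA_hom_exists:
  assumes "partial_rep R G H v"
  shows "\<exists>h \<in> algebra_hom PA R. \<forall>g\<in>carrier G. h (par_gen G H g) = v g"
proof -
  interpret R: partial_rep R G H v by fact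
  obtain h where h: "h \<in> algebra_hom FA R" "\<And>g. g \<in> carrier G \<Longrightarrow> h (basis_elem [g]) = v g"
    using free_algebra_hom_exists[OF R.complex_algebra_axioms, of v "carrier G"] by auto
  interpret h: ring_hom_ring FA R h
    by (rule algebra_hom_ring_hom_ring) (use h free.complex_algebra_axioms R.complex_algebra_axioms in auto)
  have word: "h (basis_elem w) = foldr (\<lambda>x r. v x \<otimes>\<^bsub>R\<^esub> r) w \<one>\<^bsub>R\<^esub>" if "w \<in> lists (carrier G)" for w
    unfolding hom_basis_word[OF R.complex_algebra_axioms h(1) that]
    using that by (intro foldr_cong) (auto simp: h(2))
  \<comment> \<open>Every relation is a difference of two words, so membership in the kernel becomes
    an equation between products of values of \<open>v\<close>.\<close>
  have diff: "basis_elem w - basis_elem w' \<in> a_kernel FA R h"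
    if "w \<in> lists (carrier G)" "w' \<in> lists (carrier G)" "h (basis_elem w) = h (basis_elem w')" for w w'
  proof -
    have c: "basis_elem w \<in> carrier FA" "basis_elem w' \<in> carrier FA" using that by auto
    have "h (basis_elem w \<ominus>\<^bsub>FA\<^esub> basis_elem w') = \<zero>\<^bsub>R\<^esub>"
      using c that(3) h.hom_closed[OF c(2)] unfolding a_minus_def
      by (simp only: h.hom_add h.hom_a_inv free.a_inv_closed R.r_neg)
    then show ?thesis
      using free_algebra_minus[OF c] unfolding a_kernel_def' by simp
  qed
  have "par_relations G H \<subseteq> a_kernel FA R h"
    unfolding par_relations_def
    by (intro Un_least subsetI; elim CollectE singletonE exE conjE; hypsubst; intro diff)
      (simp_all add: word R.u_one R.u_subgroup R.m_assoc[symmetric] R.u_left R.u_right)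
  then have "I \<subseteq> a_kernel FA R h"
    unfolding par_ideal_def by (intro free.genideal_minimal h.kernel_is_ideal)
  from subsetD[OF this] have "h x = \<zero>\<^bsub>R\<^esub>" if "x \<in> I" for x
    using that unfolding a_kernel_def' by simp
  from free.quotient_lift[OF par_ideal R.complex_algebra_axioms h(1) this]
  obtain k where "k \<in> algebra_hom PA R" "\<And>x. x \<in> carrier FA \<Longrightarrow> k (proj x) = h x"
    unfolding par_algebra_def proj_def by blast
  then show ?thesis
    by (intro bexI[of _ k]) (simp_all add: par_gen_proj h(2))
qed

end

theorem theorem3p9:
  fixes G :: "('a, 'm) monoid_scheme" and H :: "'a set"
  assumes "group G" and "finite (carrier G)" and "subgroup H G"
  shows "\<exists>\<phi>.
    \<phi> \<in> algebra_iso (par_algebra G H) (groupoid_algebra G H) \<and>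
    (\<forall>g\<in>carrier G. \<phi> (par_gen G H g) = mu_p G H g) \<and>
    (\<forall>\<psi>\<in>algebra_hom (par_algebra G H) (groupoid_algebra G H).
       (\<forall>g\<in>carrier G. \<psi> (par_gen G H g) = mu_p G H g) \<longrightarrow>
       (\<forall>x\<in>carrier (par_algebra G H). \<psi> x = \<phi> x)) \<and>
    (\<forall>(A, g)\<in>par_groupoid G H.
       inv_into (carrier (par_algebra G H)) \<phi> (basis_elem (A, g)) =
       par_gen G H g \<otimes>\<^bsub>par_algebra G H\<^esub> par_proj G H A)"
proof -
  interpret finite_group_subgroup G H
    using assms by (simp add: finite_group_subgroup_def finite_group_subgroup_axioms_def)
  note GA = GA.complex_algebra_axioms
  obtain \<phi> where \<phi>: "\<phi> \<in> algebra_hom PA GA" "\<And>g. g \<in> carrier G \<Longrightarrow> \<phi> (par_gen G H g) = mu_p G H g"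
    using PA_hom_exists[OF partial_rep_mu_p] by blast
  define \<nu> where "\<nu> = lin_ext PA (\<lambda>(A, g). par_gen G H g \<otimes>\<^bsub>PA\<^esub> par.P A)"
  note \<nu> = par.uP_lin_ext[OF partial_basis_groupoid, folded \<nu>_def]
  \<comment> \<open>The composite fixes each generator, hence agrees with the identity by
    \<open>PA_hom_eqI\<close>.\<close>
  have \<nu>\<phi>: "\<nu> (\<phi> x) = x" if "x \<in> carrier PA" for x
    by (rule PA_hom_eqI[OF PA_algebra algebra_hom_comp[OF \<phi>(1) \<nu>(1)] id_algebra_hom _ that])
      (simp add: \<phi>(2) \<nu>(2))
  have \<phi>_uP: "\<phi> (par_gen G H g \<otimes>\<^bsub>PA\<^esub> par.P A) = basis_elem (A, g)" if Ag: "(A, g) \<in> \<Gamma>" for A g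
  proof -
    have A: "A \<subseteq> carrier G" "g \<in> carrier G" using Ag CU_subset by (auto simp: par_groupoid_def)
    have "\<phi> (par.P A) = mu.P A"
      by (rule par.hom_P[OF \<phi>(1) partial_rep_mu_p \<phi>(2) A(1)])
    then show ?thesis
      using A Ag by (simp add: algebra_homD(2)[OF \<phi>(1)] \<phi>(2) mu_uP)
  qed
  \<comment> \<open>It suffices to test basis arrows, and \<open>\<phi>_uP\<close> shows that each
    one returns to itself.\<close>
  have \<phi>\<nu>: "\<phi> (\<nu> y) = y" if "y \<in> carrier GA" for y
  proof (rule GA.algebra_hom_eqI[OF GA algebra_hom_comp[OF \<nu>(1) \<phi>(1)] id_algebra_hom])
    show "Poly_Mapping.keys y \<subseteq> \<Gamma>" using that by (simp add: groupoid_algebra_def)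
  qed (auto simp: \<nu>(3) \<phi>_uP)
  have bij: "bij_betw \<phi> (carrier PA) (carrier GA)"
    using \<nu>\<phi> \<phi>\<nu> algebra_homD(1)[OF \<phi>(1)] algebra_homD(1)[OF \<nu>(1)]
    by (intro bij_betw_byWitness[where f' = \<nu>] ballI image_subsetI)
  show ?thesis
  proof (intro exI[of _ \<phi>] conjI ballI impI)
    show "\<phi> \<in> algebra_iso PA GA"
      using \<phi>(1) bij by (simp add: algebra_iso_def)
  next
    fix g assume "g \<in> carrier G"
    then show "\<phi> (par_gen G H g) = mu_p G H g" by (rule \<phi>(2))
  next
    fix \<psi> x assume \<psi>: "\<psi> \<in> algebra_hom PA GA" "\<forall>g\<in>carrier G. \<psi> (par_gen G H g) = mu_p G H g" "x \<in> carrier PA"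
    show "\<psi> x = \<phi> x"
      by (rule PA_hom_eqI[OF GA \<psi>(1) \<phi>(1) _ \<psi>(3)]) (simp add: \<psi>(2) \<phi>(2))
  next
    fix p assume p: "p \<in> \<Gamma>"
    show "case p of (A, g) \<Rightarrow> inv_into (carrier PA) \<phi> (basis_elem (A, g)) = par_gen G H g \<otimes>\<^bsub>PA\<^esub> par_proj G H A"
    proof (cases p)
      case (Pair A g)
      then have "A \<subseteq> carrier G" "g \<in> carrier G" using p CU_subset by (auto simp: par_groupoid_def)
      \<comment> \<open>\<open>\<phi>_uP\<close> exhibits the preimage of the arrow, and injectivity
        makes it the value of \<open>inv_into\<close>.\<close>
      then have "inv_into (carrier PA) \<phi> (basis_elem (A, g)) = par_gen G H g \<otimes>\<^bsub>PA\<^esub> par.P A"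
        using p Pair by (intro inv_into_f_eq bij_betw_imp_inj_on[OF bij] \<phi>_uP) auto
      then show ?thesis
        by (simp add: Pair par_proj_eq)
    qed
  qed
qed

end
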